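(* Let $q$ be an odd prime power, $t\ge5$, and let $s,\ell$ be positive integers with $\gcd(s,2t)=1=\gcd(\ell,2t)$. Let $m,\mu\in\mathbb{F}_{q^t}$ and $h,k\in\mathbb{F}_{q^{2t}}$ be such that $(m,h)$ is admissible for $(q,t,s)$ and $(\mu,k)$ is admissible for $(q,t,\ell)$. Then: (a) if $\ell\not\equiv\pm s\pmod{2t}$ and $\ell\not\equiv t\pm s\pmod{2t}$, then $\psi_{m,h,s}\not\sim_{\mathrm{GL}}\psi_{\mu,k,\ell}$; (b) if $\ell\equiv-s\pmod{2t}$ and $\psi_{m,h,s}\sim_{\mathrm{GL}}\psi_{\mu,k,\ell}$, then $kh\in\mathbb{F}_{q^{\gcd(t-2,2t)}}$ and one of the following holds: there exists $z\in\mathbb{F}_{q^{2t}}$ such that $z^{q^{st}}=(kh)^{q^{3s}-1}z$ and $m\mu^{q^s}=z^{q^{s(t-2)}-1}$; or there exists $z\in\mathbb{F}_{q^{2t}}$ such that $z^{q^{st}}=-(kh)^{q^{3s}-1}z$ and $m\mu=-z^{q^{s(t-2)}-1}$; (c) if $\ell\equiv s\pmod{2t}$ and $\psi_{m,h,s}\sim_{\mathrm{GL}}\psi_{\mu,k,\ell}$, then $h/k\in\mathbb{F}_{q^{\gcd(s(t-2),2t)}}$ and one of the following holds: there exists $z\in\mathbb{F}_{q^{2t}}$ such that $z^{q^{st}}=-(h/k)^{q^{3s}-1}z$ and $m\mu^{-q^{s(t-1)}}=-z^{q^{s(t-2)}-1}$; or there exists $z\in\mathbb{F}_{q^{2t}}$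 such that $z^{q^{st}}=(h/k)^{q^{3s}-1}z$ and $m/\mu=z^{q^{s(t-2)}-1}$; (d) if $\ell\equiv t-s\pmod{2t}$ and $\psi_{m,h,s}\sim_{\mathrm{GL}}\psi_{\mu,k,\ell}$, then $h/k\in\mathbb{F}_{q^{\gcd(s(t-2),2t)}}$ and one of the following holds: there exists $z\in\mathbb{F}_{q^{2t}}$ such that $z^{q^{st}}=(h/k)^{q^{3s}-1}z$ and $m\mu^{q^s}=-z^{q^{s(t-2)}-1}$; or there exists $z\in\mathbb{F}_{q^{2t}}$ such that $z^{q^{st}}=-(h/k)^{q^{3s}-1}z$ and $m\mu=z^{q^{s(t-2)}-1}$; (e) if $\ell\equiv t+s\pmod{2t}$ and $\psi_{m,h,s}\sim_{\mathrm{GL}}\psi_{\mu,k,\ell}$, then $hk\in\mathbb{F}_{q^{\gcd(s(t-2),2t)}}$ and one of the following holds: there exists $z\in\mathbb{F}_{q^{2t}}$ such that $z^{q^{st}}=-(hk)^{q^{3s}-1}z$ and $m\mu^{-q^{s(t-1)}}=z^{q^{s(t-2)}-1}$; or there exists $z\in\mathbb{F}_{q^{2t}}$ such that $z^{q^{st}}=(hk)^{q^{3s}-1}z$ and $m/\mu=-z^{q^{s(t-2)}-1}$.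
   Context: Trace and norm: $\mathrm{Tr}_{q^{2t}/q^t}(x)=x+x^{q^t}$, $\mathrm{N}_{q^{2t}/q^t}(x)=x^{q^t+1}$. For a positive integer $s$ with $\gcd(s,2t)=1$ put $\mathscr{P}^+_s=\{w^{q^s+1}: w\in\ker\mathrm{Tr}_{q^{2t}/q^t}\}$ and $\mathscr{P}^-_s=\{w^{q^s-1}: w\in\ker\mathrm{Tr}_{q^{2t}/q^t}\}$ (subsets of $\mathbb{F}_{q^t}$). A pair $(m,h)\in\mathbb{F}_{q^t}^*\times\mathbb{F}_{q^{2t}}$ is called admissible for $(q,t,s)$ if one of the following holds: (i) [$t$ even, or $t$ odd and $q\equiv1\pmod4$] and $m\notin\mathscr{P}^+_s\cup\mathscr{P}^-_s$ and $\mathrm{N}_{q^{2t}/q^t}(h)=\pm1$; (ii)(a) $t$ odd, $q\equiv3\pmod4$, $m\in\mathscr{P}^+_s$ and $\mathrm{N}_{q^{2t}/q^t}(h)=-1$; (ii)(b) $t$ odd, $q\equiv3\pmod4$, $m\notin\mathscr{P}^+_s\cup\mathscr{P}^-_s$, $\mathrm{N}_{q^{2t}/q^t}(h)=1$ and $h^2\neq-1$. $\psi_{m,h,s}= m(X^{q^s}-h^{1-q^{s(t+1)}}X^{q^{s(t+1)}})+X^{q^{s(t-1)}}+h^{1-q^{s(2t-1)}}X^{q^{s(2t-1)}}$, viewed as an $\mathbb{F}_q$-linear map of $\mathbb{F}_{q^{2t}}$ (exponents of $q$ taken modulo $2t$); $\psi_{\mu,k,\ell}$ is defined likewise with $(\mu,k,\ell)$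 in place of $(m,h,s)$. For a linearized polynomial $f$ over $\mathbb{F}_{q^{2t}}$ let $U_f=\{(x,f(x)):x\in\mathbb{F}_{q^{2t}}\}$. Write $f\sim_{\mathrm{GL}}g$ if $U_f$ and $U_g$ lie in the same orbit of $\mathrm{GL}(2,q^{2t})$ acting on $\mathbb{F}_q$-subspaces of $\mathbb{F}_{q^{2t}}^2$. *)

theory Defs
  imports "HOL-Analysis.Analysis" "HOL-Number_Theory.Number_Theory"
begin

(* The ambient field of order q^(2t) is a finite field type 'a with CARD('a) = q^(2*t).
   For d dividing 2t, its unique subfield of order q^d is the fixed set of x |-> x^(q^d). *)
definition subfield_of_order :: "nat \<Rightarrow> 'a::field set" where
  "subfield_of_order n = {x. x ^ n = x}"

definition rel_trace :: "nat \<Rightarrow> nat \<Rightarrow> 'a::field \<Rightarrow> 'a" where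
  "rel_trace q t x = x + x ^ (q ^ t)"

definition rel_norm :: "nat \<Rightarrow> nat \<Rightarrow> 'a::field \<Rightarrow> 'a" where
  "rel_norm q t x = x ^ (q ^ t + 1)"

definition P_plus :: "nat \<Rightarrow> nat \<Rightarrow> nat \<Rightarrow> 'a::field set" where
  "P_plus q t s = {w ^ (q ^ s + 1) | w. rel_trace q t w = 0}"

definition P_minus :: "nat \<Rightarrow> nat \<Rightarrow> nat \<Rightarrow> 'a::field set" where
  "P_minus q t s = {w ^ (q ^ s - 1) | w. rel_trace q t w = 0}"

definition admissible :: "nat \<Rightarrow> nat \<Rightarrow> nat \<Rightarrow> 'a::field \<Rightarrow> 'a \<Rightarrow> bool" where
  "admissible q t s m h \<longleftrightarrow>
     m \<in> subfield_of_order (q ^ t) \<and> m \<noteq> 0 \<and>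
     ((even t \<or> odd t \<and> [q = 1] (mod 4)) \<and>
        m \<notin> P_plus q t s \<union> P_minus q t s \<and> (rel_norm q t h = 1 \<or> rel_norm q t h = - 1)
      \<or> odd t \<and> [q = 3] (mod 4) \<and>
        m \<in> P_plus q t s \<and> rel_norm q t h = - 1
      \<or> odd t \<and> [q = 3] (mod 4) \<and>
        m \<notin> P_plus q t s \<union> P_minus q t s \<and> rel_norm q t h = 1 \<and> h\<^sup>2 \<noteq> - 1)"

(* The exponents of q are not reduced modulo 2t: since x^(q^(2t)) = x throughout the field,
   both the coefficients and the resulting map are unaffected by the reduction. *)
definition psi :: "nat \<Rightarrow> nat \<Rightarrow> 'a::field \<Rightarrow> 'a \<Rightarrow> nat \<Rightarrow> 'a \<Rightarrow> 'a" where
  "psi q t m h s x =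
     m * (x ^ (q ^ s) - h powi (1 - int q ^ (s * (t + 1))) * x ^ (q ^ (s * (t + 1))))
     + x ^ (q ^ (s * (t - 1)))
     + h powi (1 - int q ^ (s * (2 * t - 1))) * x ^ (q ^ (s * (2 * t - 1)))"

definition graph_subspace :: "('a::field \<Rightarrow> 'a) \<Rightarrow> ('a ^ 2) set" where
  "graph_subspace f = {vector [x, f x] | x. True}"

definition GL_equiv :: "('a::field \<Rightarrow> 'a) \<Rightarrow> ('a \<Rightarrow> 'a) \<Rightarrow> bool" (infix "\<sim>GL" 50) where
  "f \<sim>GL g \<longleftrightarrow>
     (\<exists>A :: 'a ^ 2 ^ 2. invertible A \<and> (\<lambda>v. A *v v) ` graph_subspace f = graph_subspace g)"

end

theory Submission
  imports Defs
begin

text \<open>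
  Let \<open>K\<close> be the field of order \<open>q^(2t)\<close>, \<open>E\<close> its subfield of order \<open>q^t\<close>, \<open>S\<close> the automorphism
  \<open>x \<mapsto> x^(q^s)\<close>, \<open>T\<close> its inverse and \<open>B\<close> the conjugation of \<open>K\<close> over \<open>E\<close>. Since the norm \<open>e\<close> of \<open>h\<close> is a
  sign, \<open>psi\<close> is the sum of a forward part \<open>m (S x - e h S(h) S(B x))\<close> and a backward part
  \<open>T(B x) + (h / T h) T x\<close>. Over \<open>E\<close>, these are semilinear maps of rank one, of degrees \<open>s\<close> and
  \<open>- s\<close> in the group of integers modulo \<open>t\<close>. Their images are the lines on which \<open>B\<close> acts as
  \<open>- e / (h S h)\<close> and as \<open>T h / h\<close>, and admissibility is what makes these lines distinct
  (\<open>nondegenerate\<close>, \<open>fwd_bwd_images_disjoint\<close>).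

  A linear equivalence of the graphs of \<open>f\<close> and \<open>g\<close> is an identity \<open>g (a x + b f x) = c x + d f x\<close> with
  \<open>a d - b c \<noteq> 0\<close>. Semilinear maps of different degrees are independent (\<open>homogeneous_components\<close>), so
  the identity holds degree by degree. If \<open>l\<close> differs from \<open>\<plusminus> s\<close> modulo \<open>t\<close>, degree 0 gives \<open>c = 0\<close> and
  degree \<open>l\<close> gives \<open>a = 0\<close> by the distinctness of the images (\<open>no_equivalence_other_degree\<close>).

  If \<open>l\<close> and \<open>s\<close> agree modulo \<open>2t\<close>, degrees \<open>\<plusminus> s\<close> relate the parts of \<open>g\<close> at \<open>a x\<close> to \<open>d\<close> times the parts of \<open>f\<close>, degrees
  \<open>\<plusminus> 2 s\<close> say that the forward parts compose to zero through \<open>b\<close>, as do the backward parts, and degree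
  0 says that the mixed compositions add up to the multiplication by \<open>c\<close>. For nonzero \<open>a\<close> the first set of
  equations yields one alternative of the conclusion (\<open>proportional_parts\<close>); for \<open>a = 0\<close> the others
  yield the second (\<open>annihilating_parts\<close>). In both, the conjugate of the unknown \<open>a\<close> or \<open>b\<close> is
  computed twice, and comparison shows that \<open>S (S v) v\<close> is the same sign as \<open>B(v) v\<close> for \<open>v = h / k\<close>, whence
  \<open>v\<close> is fixed by \<open>x \<mapsto> x^(q^(s(t-2)))\<close>; the element \<open>z\<close> is an explicit expression in \<open>a\<close> or \<open>b\<close>.

  The remaining cases \<open>l = - s\<close>, \<open>l = t \<plusminus> s\<close> modulo \<open>2t\<close> reduce to \<open>l = s\<close>: after a substitution \<open>x \<mapsto> u x\<close> and
  a scaling, \<open>psi\<close> with exponent \<open>l\<close> becomes a quadrinomial with exponent \<open>s\<close> whose parameters are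
  obtained from \<open>\<mu>\<close> and \<open>k\<close> by inversion, sign changes and factors built from an element \<open>w\<close> with
  \<open>B w = - w\<close>; the latter are absorbed into \<open>z\<close>.
\<close>

section \<open>A field automorphism commuting with an involution\<close>

text \<open>
  The coefficient computations use only that \<open>S\<close> (a power of the Frobenius map) is an automorphism
  with inverse \<open>T\<close> that commutes with the involution \<open>B\<close> (the conjugation of \<open>F_{q^(2t)}\<close> over
  \<open>F_{q^t}\<close>). An element with \<open>B w = - w\<close> makes \<open>B\<close> independent of the identity.
\<close>
locale conjugation =
  fixes S T B :: "'a::field \<Rightarrow> 'a"
  assumes S_add: "S (x + y) = S x + S y" and S_mult: "S (x * y) = S x * S y"
    and B_add: "B (x + y) = B x + B y" and B_mult: "B (x * y) = B x * B y"
    and T_S: "T (S x) = x" and S_T: "S (T x) = x"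
    and B_B: "B (B x) = x" and B_S: "B (S x) = S (B x)"
    and ex_skew: "\<exists>w. w \<noteq> 0 \<and> B w = - w"
    and two_neq_0: "(2::'a) \<noteq> 0"
begin

lemma T_add: "T (x + y) = T x + T y"
  by (metis S_T S_add T_S)

lemma T_mult: "T (x * y) = T x * T y"
  by (metis S_T S_mult T_S)

lemma B_T: "B (T x) = T (B x)"
  by (metis B_S S_T T_S)

lemma fix_0: "S 0 = 0" "T 0 = 0" "B 0 = 0"
proof -
  have "x = x + x \<Longrightarrow> x = 0" for x :: 'a
    by (metis add_cancel_right_right)
  then show "S 0 = 0" "T 0 = 0" "B 0 = 0"
    using S_add[of 0 0] T_add[of 0 0] B_add[of 0 0] by (metis add_0)+
qed

lemma eq_0_iff: "S x = 0 \<longleftrightarrow> x = 0" "T x = 0 \<longleftrightarrow> x = 0" "B x = 0 \<longleftrightarrow> x = 0"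
  by (metis T_S fix_0, metis S_T fix_0, metis B_B fix_0)

lemma fix_1: "S 1 = 1" "T 1 = 1" "B 1 = 1"
  using S_mult[of 1 1] T_mult[of 1 1] B_mult[of 1 1] by (simp_all add: eq_0_iff)

lemma fix_minus: "S (- x) = - S x" "T (- x) = - T x" "B (- x) = - B x"
  using S_add[of x "- x"] T_add[of x "- x"] B_add[of x "- x"]
  by (simp_all add: fix_0 eq_neg_iff_add_eq_0 add.commute)

lemma fix_diff: "S (x - y) = S x - S y" "T (x - y) = T x - T y" "B (x - y) = B x - B y"
  using S_add[of x "- y"] T_add[of x "- y"] B_add[of x "- y"] by (simp_all add: fix_minus)

lemma fix_inverse: "S (inverse x) = inverse (S x)" "T (inverse x) = inverse (T x)"
    "B (inverse x) = inverse (B x)"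
proof -
  have "S (inverse x) = inverse (S x) \<and> T (inverse x) = inverse (T x) \<and>
    B (inverse x) = inverse (B x)"
  proof (cases "x = 0")
    case False
    then have "S x * S (inverse x) = 1" "T x * T (inverse x) = 1" "B x * B (inverse x) = 1"
      by (simp_all add: fix_1 flip: S_mult T_mult B_mult)
    then show ?thesis
      by (simp add: inverse_unique)
  qed (simp add: fix_0)
  then show "S (inverse x) = inverse (S x)" "T (inverse x) = inverse (T x)"
    "B (inverse x) = inverse (B x)" by auto
qed

lemma fix_divide: "S (x / y) = S x / S y" "T (x / y) = T x / T y" "B (x / y) = B x / B y"
  by (simp_all add: divide_inverse S_mult T_mult B_mult fix_inverse)

lemmas hom_simps = S_add S_mult T_add T_mult B_add B_mult T_S S_T B_B B_S B_T
  fix_0 fix_1 fix_minus fix_diff fix_divide eq_0_iff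

lemma fix_sign: "e = 1 \<or> e = - 1 \<Longrightarrow> S e = e \<and> T e = e \<and> B e = e"
  by (auto simp: hom_simps)

lemma conj_coeffs_unique:
  assumes "\<And>x. \<alpha> * x + \<beta> * B x = \<alpha>' * x + \<beta>' * B x"
  shows "\<alpha> = \<alpha>' \<and> \<beta> = \<beta>'"
proof -
  obtain w where w: "w \<noteq> 0" "B w = - w"
    using ex_skew by blast
  have 1: "\<alpha> + \<beta> = \<alpha>' + \<beta>'"
    using assms[of 1] by (simp add: hom_simps)
  have "(\<alpha> - \<beta>) * w = (\<alpha>' - \<beta>') * w"
    using assms[of w] w by (simp add: algebra_simps)
  then have "\<alpha> - \<beta> = \<alpha>' - \<beta>'"
    using w by simp
  with 1 have "(\<alpha> + \<beta>) + (\<alpha> - \<beta>) = (\<alpha>' + \<beta>') + (\<alpha>' - \<beta>')"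
    by simp
  then have "2 * \<alpha> = 2 * \<alpha>'"
    by simp
  with 1 show ?thesis
    using two_neq_0 by simp
qed

text \<open>
  If \<open>B h = e / h\<close> with a sign \<open>e\<close>, the quadrinomial \<open>psi\<close> is \<open>fwd + bwd\<close>: the coefficient
  \<open>h / S (B h)\<close> has been rewritten as \<open>e * h * S h\<close>. The two summands collect the terms in \<open>S\<close> and
  those in the inverse \<open>T\<close>; over the fixed field of \<open>B\<close> each is semilinear of rank one.
\<close>
definition fwd :: "'a \<Rightarrow> 'a \<Rightarrow> 'a \<Rightarrow> 'a \<Rightarrow> 'a"
  where "fwd m h e x = m * (S x - e * h * S h * S (B x))"

definition bwd :: "'a \<Rightarrow> 'a \<Rightarrow> 'a"
  where "bwd h x = T (B x) + h / T h * T x"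

context
  fixes h e :: 'a
  assumes h: "h \<noteq> 0" "B h = e / h" and e: "e = 1 \<or> e = - 1"
begin

text \<open>
  Up to scalars, \<open>B\<close> exchanges the two monomials of each part, because it inverts \<open>h * S h\<close> as well as
  \<open>h / T h\<close>. Hence it acts by a known scalar on each image.
\<close>
lemma B_fwd: "B m = m \<Longrightarrow> B (fwd m h e x) = - e / (h * S h) * fwd m h e x"
  by (simp add: fwd_def hom_simps h fix_sign[OF e])
    (use h e in \<open>auto simp: hom_simps field_simps\<close>)

lemma B_bwd: "B (bwd h x) = T h / h * bwd h x"
  by (simp add: bwd_def hom_simps h fix_sign[OF e])
    (use h e in \<open>auto simp: hom_simps field_simps\<close>)

end

text \<open>
  The two image lines coincide exactly when their conjugation scalars agree, which amounts to
  \<open>h * S (S h) = - e\<close>.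
\<close>
lemma fwd_bwd_images_disjoint:
  assumes h: "h \<noteq> 0" "B h = e / h" and e: "e = 1 \<or> e = - 1"
    and m: "B m = m" and nondeg: "1 + e * h * S (S h) \<noteq> 0"
    and eq: "fwd m h e x = bwd h y"
  shows "fwd m h e x = 0"
proof (rule ccontr)
  assume nz: "fwd m h e x \<noteq> 0"
  have "- e / (h * S h) * fwd m h e x = T h / h * fwd m h e x"
    using B_fwd[OF h e m, of x] B_bwd[OF h e, of y] eq by simp
  then have "- e / (h * S h) = T h / h"
    using nz by (metis mult_right_cancel)
  then have "S (- e) = S (S h * T h)"
    using h(1) by (simp add: hom_simps field_simps)
  then have "- e = S (S h) * h"
    using fix_sign[OF e] by (simp add: hom_simps)
  then have "e * (- e) = e * (S (S h) * h)" by simp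
  then have "1 + e * h * S (S h) = 1 - e * e" by (simp add: mult_ac)
  with nondeg e show False by auto
qed

lemma fwd_nz:
  assumes "m \<noteq> 0"
  shows "\<exists>x. fwd m h e x \<noteq> 0"
proof (rule ccontr)
  assume "\<not> ?thesis"
  then have *: "fwd m h e x = 0" for x by auto
  have "1 * x + (- (e * h * S h)) * B x = 0 * x + 0 * B x" for x
    using *[of "T x"] assms by (simp add: fwd_def hom_simps)
  from conj_coeffs_unique[OF this] show False by auto
qed

lemma bwd_nz: "\<exists>x. bwd h x \<noteq> 0"
proof (rule ccontr)
  assume "\<not> ?thesis"
  then have *: "bwd h x = 0" for x by auto
  have "(h / T h) * x + 1 * B x = 0 * x + 0 * B x" for x
    using *[of "S x"] by (simp add: bwd_def hom_simps add.commute)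
  from conj_coeffs_unique[OF this] show False by auto
qed

text \<open>
  The first way in which an equivalence can arise: the substitution \<open>x \<mapsto> a x\<close> carries both parts
  of one quadrinomial to multiples of the parts of the other. Comparing the coefficients of each
  part gives two expressions for \<open>B a / a\<close>; their agreement is the condition on \<open>v = h / k\<close>, and the
  remaining coefficient equations express \<open>m / \<mu>\<close> through \<open>a\<close>.
\<close>
lemma proportional_parts:
  fixes m \<mu> h k e e' a d :: 'a
  defines "v \<equiv> h / k"
  assumes nz: "m \<noteq> 0" "\<mu> \<noteq> 0" "a \<noteq> 0" "d \<noteq> 0"
    and h: "h \<noteq> 0" "B h = e / h" and e: "e = 1 \<or> e = - 1"
    and k: "k \<noteq> 0" "B k = e' / k" and e': "e' = 1 \<or> e' = - 1"
    and fw: "\<And>x. fwd \<mu> k e' (a * x) = d * fwd m h e x"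
    and bw: "\<And>x. bwd k (a * x) = d * bwd h x"
  shows "S (S v) * v = e * e'"
    and "B (1 / S a) = S (S (S v)) / v * (1 / S a)"
    and "m / \<mu> = T (T (B (1 / S a))) / (1 / S a)"
proof -
  have sgn: "e * e = 1" "e' * e' = 1" "e \<noteq> 0" "e' \<noteq> 0" using e e' by auto
  note fx = fix_sign[OF e] fix_sign[OF e']
  have "(\<mu> * S a) * x + (- (\<mu> * e' * k * S k * S (B a))) * B x
      = (d * m) * x + (- (d * m * e * h * S h)) * B x" for x
    using fw[of "T x"] by (simp add: fwd_def hom_simps algebra_simps)
  from conj_coeffs_unique[OF this]
  have f: "\<mu> * S a = d * m" "\<mu> * e' * k * S k * S (B a) = d * m * e * h * S h" by auto
  have "(k / T k * T a) * x + T (B a) * B x = (d * (h / T h)) * x + d * B x" for x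
    using bw[of "S x"] by (simp add: bwd_def hom_simps algebra_simps)
  from conj_coeffs_unique[OF this] have b: "k / T k * T a = d * (h / T h)" "T (B a) = d" by auto
  have v: "v \<noteq> 0" "h = v * k" using h k by (auto simp: v_def)
  have "T k * T v * T a = v * T k * T (B a)"
    using b v k by (simp add: hom_simps field_simps)
  then have "T v * T a = v * T (B a)" using k by (simp add: hom_simps)
  then have "S (T v * T a) = S (v * T (B a))" by simp
  then have Ba: "v * a = S v * B a" by (simp add: hom_simps)
  have "\<mu> * k * S k * (e' * S (B a)) = \<mu> * k * S k * (e * v * S v * S a)"
    using f(2) by (simp add: v(2) flip: f(1)) (simp add: hom_simps mult_ac)
  then have "e' * S (B a) = e * v * S v * S a" using nz k by (simp add: hom_simps)
  then have "T (e' * S (B a)) = T (e * v * S v * S a)" by simp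
  then have Ba2: "e' * B a = e * T v * v * a" using fx by (simp add: hom_simps)
  have "v * a * e' = S v * (e' * B a)"
    by (metis Ba mult.assoc mult.commute)
  also have "... = S v * (e * T v * v * a)"
    by (simp only: Ba2)
  finally have "(v * a) * e' = (v * a) * (e * (S v * T v))" by (simp add: mult_ac)
  then have "e' = e * (S v * T v)" using nz v by simp
  then have ST: "S v * T v = e * e'" using sgn by (metis mult.assoc mult_1)
  then have "S (S v * T v) = S (e * e')" by simp
  then show SS: "S (S v) * v = e * e'" using fx by (simp add: hom_simps)
  have Ba': "B a = v * a / S v"
    using Ba v by (simp add: field_simps hom_simps)
  have "S (S (S v) * v) = S (e * e')" by (simp add: SS)
  then have SSS: "S (S (S v)) * S v = e * e'" using fx by (simp add: hom_simps)
  have "S (S v) * v = S (S (S v)) * S v" using SS SSS by simp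
  then show "B (1 / S a) = S (S (S v)) / v * (1 / S a)"
    using v nz by (simp add: hom_simps Ba') (simp add: hom_simps field_simps)
  have "m / \<mu> = S a / T (B a)"
    using f(1) b(2) nz by (simp add: field_simps)
  also have "... = T (T (B (1 / S a))) / (1 / S a)"
    using v nz by (simp add: hom_simps)
  finally show "m / \<mu> = T (T (B (1 / S a))) / (1 / S a)" .
qed

text \<open>
  The second way: \<open>b\<close> carries the image of each part of one quadrinomial into the kernel of the
  corresponding part of the other. As images and kernels are lines on which \<open>B\<close> acts by known
  scalars, this yields two expressions for \<open>B b / b\<close>, hence the condition on \<open>v\<close>. The mixed compositions
  add up to a multiplication by \<open>c\<close>, so the coefficient of \<open>B x\<close> in their sum vanishes; this is the
  relation between \<open>m\<close> and \<open>\<mu>\<close>. The factor \<open>A\<close> that enters is nonzero when the two image lines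
  are distinct, and \<open>z\<close> is chosen to absorb it together with \<open>b\<close>.
\<close>
lemma annihilating_parts:
  fixes m \<mu> h k e e' b c :: 'a
  defines "v \<equiv> h / k" and "A \<equiv> 1 + e * h * S (S h)"
  defines "z \<equiv> v * S h / (S (S b) * S A)"
  assumes nz: "m \<noteq> 0" "\<mu> \<noteq> 0" "b \<noteq> 0" "A \<noteq> 0"
    and real: "B m = m" "B \<mu> = \<mu>"
    and h: "h \<noteq> 0" "B h = e / h" and e: "e = 1 \<or> e = - 1"
    and k: "k \<noteq> 0" "B k = e' / k" and e': "e' = 1 \<or> e' = - 1"
    and ff: "\<And>x. fwd \<mu> k e' (b * fwd m h e x) = 0"
    and bb: "\<And>x. bwd k (b * bwd h x) = 0"
    and mid: "\<And>x. fwd \<mu> k e' (b * bwd h x) + bwd k (b * fwd m h e x) = c * x"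
  shows "S (S v) * v = e * e'"
    and "B z = - (S (S (S v)) / v) * z"
    and "m / S \<mu> = - (T (T (B z)) / z)"
proof -
  have sgn: "e * e = 1" "e' * e' = 1" "e \<noteq> 0" "e' \<noteq> 0" using e e' by auto
  note fx = fix_sign[OF e] fix_sign[OF e']
  note hn = eq_0_iff h(1) k(1) nz sgn
  obtain x where w: "fwd m h e x \<noteq> 0" using fwd_nz[OF nz(1)] by blast
  have "S (b * fwd m h e x) = e' * k * S k * S (B (b * fwd m h e x))"
    using ff[of x] nz by (simp add: fwd_def[of \<mu>])
  then have "S (fwd m h e x) * S b
      = S (fwd m h e x) * (e' * k * S k * (- e / (S h * S (S h))) * S (B b))"
    by (simp add: hom_simps B_fwd[OF h e real(1)] fx mult_ac)
  then have i: "S b = e' * k * S k * (- e / (S h * S (S h))) * S (B b)"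
    using w by (metis eq_0_iff(1) mult_left_cancel)
  then have Sb: "S b * S h * S (S h) = - (e * e') * k * S k * S (B b)"
    using hn by (simp add: field_simps)
  obtain x' where w': "bwd h x' \<noteq> 0" using bwd_nz by blast
  have "S (T (B (b * bwd h x'))) + S (k / T k) * S (T (b * bwd h x')) = 0"
    using bb[of x'] by (simp add: bwd_def[of k] fix_0 flip: S_add S_mult)
  then have "bwd h x' * (B b * (T h / h) + S k / k * b) = 0"
    by (simp add: hom_simps B_bwd[OF h e] fx algebra_simps)
  then have "B b * (T h / h) + S k / k * b = 0"
    using w' by simp
  then have Bb: "B b = - b * h * S k / (k * T h)"
    using hn by (simp add: field_simps add_eq_0_iff)
  have "S (B b) = - S b * S h * S (S k) / (S k * h)"
    by (simp add: Bb hom_simps)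
  then have "S b * S h * S (S h) * h = S b * S h * ((e * e') * k * S (S k))"
    using Sb hn by simp
  then have "S (S h) * h = (e * e') * k * S (S k)"
    using hn by simp
  then show SS: "S (S v) * v = e * e'"
    using hn by (simp add: v_def hom_simps field_simps)
  have BA: "B A = e * A / (h * S (S h))"
    using hn by (simp add: A_def hom_simps h fx field_simps)
  \<comment> \<open>The mixed compositions, with \<open>B b\<close> eliminated.\<close>
  have fb: "fwd \<mu> k e' (b * bwd h x) = \<mu> * S b * A * (B x + S h / h * x)" for x
  proof -
    have "fwd \<mu> k e' (b * bwd h x)
        = \<mu> * (S b * S (bwd h x) - (e' * k * S k * S (B b)) * (h / S h) * S (bwd h x))"
      by (simp add: fwd_def[of \<mu>] hom_simps B_bwd[OF h e] mult_ac)
    also have "e' * k * S k * S (B b) = - e * (S b * S h * S (S h))"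
      using sgn by (simp add: Sb mult.assoc[symmetric])
    also have "\<mu> * (S b * S (bwd h x) - (- e * (S b * S h * S (S h))) * (h / S h) * S (bwd h x))
        = \<mu> * S b * A * S (bwd h x)"
      using hn by (simp add: A_def field_simps)
    also have "S (bwd h x) = B x + S h / h * x"
      by (simp add: bwd_def hom_simps)
    finally show ?thesis .
  qed
  have bf: "bwd k (b * fwd m h e x)
      = T b * T m * (x - e * h * T h * B x) * (k / T k) * (e * T (T A) / (h * T (T h)))" for x
  proof -
    have TBb: "T (B b) = - T b * T h * k / (T k * T (T h))"
      by (simp add: Bb hom_simps)
    have "bwd k (b * fwd m h e x)
        = T (fwd m h e x) * (T (B b) * (- e / (T h * h)) + (k / T k) * T b)"
      by (simp add: bwd_def[of k] hom_simps B_fwd[OF h e real(1)] fx algebra_simps)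
    also have "T (B b) * (- e / (T h * h)) + (k / T k) * T b
        = T b * (k / T k) * (e * T (T A) / (h * T (T h)))"
      using hn by (simp add: TBb A_def hom_simps fx field_simps)
    finally show ?thesis
      by (simp add: fwd_def hom_simps fx mult_ac)
  qed
  define P where "P = T b * T m * (k / T k) * (e * T (T A) / (h * T (T h)))"
  have "(\<mu> * S b * A * (S h / h) + P) * x + (\<mu> * S b * A - P * (e * h * T h)) * B x
      = c * x + 0 * B x" for x
    using mid[of x] by (simp add: fb bf P_def algebra_simps)
  from conj_coeffs_unique[OF this] have "\<mu> * S b * A = P * (e * h * T h)" by simp
  also have "... = T b * T m * (k / T k) * (T (T A) * T h / T (T h))"
    using hn by (simp add: P_def field_simps)
  finally have "S (\<mu> * S b * A) = S (T b * T m * (k / T k) * (T (T A) * T h / T (T h)))" by simp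
  then have m: "S \<mu> * S (S b) * S A = b * m * (S k / k) * (T A * h / T h)"
    by (simp add: hom_simps)
  have v: "v \<noteq> 0" using hn by (simp add: v_def)
  have Bv: "B v = (e * e') / v"
    using hn by (simp add: v_def hom_simps h k field_simps)
  have SSv: "S (S v) = (e * e') / v"
    using SS v by (simp add: field_simps)
  have SSBb: "S (S (B b)) = - S (S b) * S (S h) * S (S (S k)) / (S (S k) * S h)"
    by (simp add: Bb hom_simps)
  have "B z = (e * e') / v * (e / S h) * (S (S k) * S h / (- S (S b) * S (S h) * S (S (S k))))
     * (S h * S (S (S h)) / (e * S A))"
    by (simp add: z_def hom_simps Bv h SSBb BA fx)
  also have "... = - (e * e') / (v * S (S v)) * S (S (S v)) / (S (S b) * S A) * S h"
    using hn by (simp add: v_def hom_simps field_simps)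
  also have "... = - (S (S (S v)) / v) * z"
    using hn v by (simp add: z_def SSv field_simps)
  finally show Bz: "B z = - (S (S (S v)) / v) * z" .
  have "T (T (B z)) / z = - (S v / T (T v)) * T (T z) / z"
    by (simp add: Bz hom_simps)
  also have "... = - (S v * T h * S (S b) * S A / (b * T A * v * S h))"
    using hn v by (simp add: z_def hom_simps field_simps)
  also have "... = - (S (S b) * S A * k * T h / (b * S k * T A * h))"
    using hn by (simp add: v_def hom_simps field_simps)
  also have "... = - (m / S \<mu>)"
    using m hn by (simp add: field_simps)
  finally show "m / S \<mu> = - (T (T (B z)) / z)" by simp
qed

end

section \<open>Frobenius powers and the grading modulo t\<close>

lemma finite_field_power_card:
  fixes x :: "'a::{field,finite}"
  shows "x ^ CARD('a) = x"
proof (cases "x = 0")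
  case False
  have inj: "inj_on ((*) x) (UNIV - {0})"
    using False by (simp add: inj_on_def)
  moreover have "(*) x ` (UNIV - {0}) \<subseteq> UNIV - {0}"
    using False by auto
  ultimately have perm: "(*) x ` (UNIV - {0}) = UNIV - {0}"
    by (intro endo_inj_surj) auto
  have "x ^ (CARD('a) - 1) * \<Prod>(UNIV - {0}) = (\<Prod>y\<in>UNIV - {0}. x * y)"
    by (simp add: prod.distrib)
  also have "... = \<Prod>(UNIV - {0})"
    using prod.reindex[OF inj, of "\<lambda>y. y"] by (simp add: perm)
  finally have "x ^ (CARD('a) - 1) = 1"
    by simp
  then show ?thesis
    using power_minus_mult[of "CARD('a)" x] by simp
qed (simp add: zero_power)

text \<open>
  The Frobenius powers enter as a parameter, so that calculations are governed by the law
  \<open>frob m \<circ> frob n = frob (m + n)\<close> rather than by arithmetic with the exponents \<open>q^n\<close>.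
\<close>
locale frobenius_tower =
  fixes q t :: nat and frob :: "nat \<Rightarrow> 'a::{field,finite} \<Rightarrow> 'a"
  assumes q: "primepow q" "odd q"
    and card: "CARD('a) = q ^ (2 * t)"
    and t: "t \<ge> 5"
    and frob: "frob n x = x ^ (q ^ n)"
begin

lemma q_gt_1: "q > 1"
  using q(1) by (rule primepow_gt_Suc_0[unfolded One_nat_def[symmetric]])

lemma frob_mult: "frob n (x * y) = frob n x * frob n y"
  by (simp add: frob power_mult_distrib)

lemma frob_frob: "frob m (frob n x) = frob (m + n) x"
  by (simp add: frob power_add power_mult[symmetric] mult.commute)

lemma frob_0: "frob 0 x = x"
  by (simp add: frob)

lemma frob_period: "frob (2 * t) x = x"
  using finite_field_power_card[of x] by (simp add: frob card)

lemma frob_add: "frob n (x + y) = frob n x + frob n y"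
proof -
  have "finite (UNIV :: 'a set)" by simp
  then have p: "prime CHAR('a)"
    by (rule prime_CHAR_semidom[OF finite_imp_CHAR_pos])
  have "CHAR('a) dvd q"
    using CHAR_dvd_CARD[where 'a='a] prime_dvd_power[OF p] by (simp add: card)
  then obtain j where "q = CHAR('a) ^ j"
    using q(1) p unfolding primepow_def by (metis prime_dvd_power primes_dvd_imp_eq)
  then show ?thesis
    unfolding frob by (intro freshmans_dream'[OF p, of _ "j * n"]) (simp add: power_mult)
qed

lemma two_neq_0: "(2::'a) \<noteq> 0"
proof
  assume "(2::'a) = 0"
  then have "of_nat 2 = (0::'a)" by simp
  then have "CHAR('a) dvd 2" by (simp only: of_nat_eq_0_iff_char_dvd)
  moreover have "CHAR('a) \<noteq> 1" by simp
  ultimately have "CHAR('a) = 2"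
    using prime_nat_iff two_is_prime_nat by blast
  then have "2 dvd q ^ (2 * t)"
    using CHAR_dvd_CARD[where 'a='a] by (simp add: card)
  then show False
    using q(2) by (simp add: even_power)
qed

lemma frob_mult_period: "frob (n * j) x = x" if "frob n x = x"
  using that by (induction j) (simp_all add: frob_0 flip: frob_frob)

lemma frob_cong_fixed:
  assumes "frob d x = x" "[m = n] (mod d)"
  shows "frob m x = frob n x"
proof -
  have "frob m x = frob (m mod d) x" for m
    using frob_frob[of "m mod d" "d * (m div d)" x] frob_mult_period[OF assms(1), of "m div d"]
    by simp
  then show ?thesis
    using assms(2) unfolding cong_def by metis
qed

lemma frob_cong: "[m = n] (mod 2 * t) \<Longrightarrow> frob m x = frob n x"
  by (rule frob_cong_fixed[OF frob_period])

lemma frob_gcd_fixed: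
  assumes "frob m x = x" "frob n x = x" "m > 0"
  shows "frob (gcd m n) x = x"
proof -
  obtain i j where "m * i = n * j + gcd m n"
    using bezout_nat[of m n] assms(3) by auto
  then have "frob (gcd m n + n * j) x = x"
    using frob_mult_period[OF assms(1), of i] by (simp add: add.commute)
  then show ?thesis
    by (simp add: frob_mult_period[OF assms(2)] flip: frob_frob)
qed

lemma card_trinomial_roots: "card {y. c * y + frob t y = w} \<le> q ^ t"
proof -
  let ?p = "Polynomial.monom 1 (q ^ t) + [:- w, c:]"
  have qt: "q ^ t > 1" using q_gt_1 t by (intro one_less_power) auto
  have "degree [:- w, c:] \<le> 1" by simp
  also have "... < degree (Polynomial.monom (1::'a) (q ^ t))"
    using qt by (simp add: degree_monom_eq)
  finally have deg: "degree ?p = q ^ t"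
    by (subst degree_add_eq_left) (simp_all add: degree_monom_eq)
  then have "?p \<noteq> 0" using qt by (intro notI) (simp only: degree_0)
  from card_poly_roots_bound[OF this] have "card {y. poly ?p y = 0} \<le> q ^ t"
    unfolding deg .
  moreover have "{y. c * y + frob t y = w} = {y. poly ?p y = 0}"
    by (auto simp: frob poly_monom algebra_simps)
  ultimately show ?thesis by simp
qed

lemma frob_neq_id: "\<exists>x. frob t x \<noteq> x"
proof (rule ccontr)
  assume "\<not> ?thesis"
  then have "{y. (- 1) * y + frob t y = 0} = UNIV" by simp
  with card_trinomial_roots[of "- 1" 0] have "CARD('a) \<le> q ^ t" by simp
  moreover have "q ^ t < q ^ (2 * t)"
    using q_gt_1 t by (intro power_strict_increasing) auto
  ultimately show False by (simp add: card)
qed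

text \<open>
  The trace \<open>y \<mapsto> y + frob t y\<close> maps the field of order \<open>q^(2t)\<close> into the fixed field of \<open>frob t\<close>, and
  its fibres are root sets of polynomials of degree \<open>q^t\<close>.
\<close>
lemma card_mid_subfield: "card {y. frob t y = y} \<ge> q ^ t"
proof -
  let ?E = "{y. frob t y = y}"
  let ?Fib = "\<lambda>w. {y. y + frob t y = w}"
  have fib: "card (?Fib w) \<le> q ^ t" for w
    using card_trinomial_roots[of 1 w] by simp
  have "y + frob t y \<in> ?E" for y
    using frob_period[of y] by (simp add: frob_add frob_frob add.commute flip: mult_2)
  then have "UNIV = (\<Union>w\<in>?E. ?Fib w)" by auto
  then have "CARD('a) = card (\<Union>w\<in>?E. ?Fib w)"
    by (rule arg_cong)
  also have "... \<le> (\<Sum>w\<in>?E. card (?Fib w))"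
    by (rule card_UN_le) simp
  also have "... \<le> card ?E * q ^ t"
    using sum_bounded_above[of ?E "\<lambda>w. card (?Fib w)" "q ^ t"] fib by simp
  finally have "q ^ t * q ^ t \<le> card ?E * q ^ t"
    by (simp add: card mult_2 power_add)
  then show ?thesis
    using q_gt_1 by simp
qed

text \<open>
  Semilinearity over the fixed field of \<open>frob t\<close>. On that field, \<open>frob n\<close> depends on \<open>n\<close> modulo \<open>t\<close> only;
  degrees are taken to be integers so that \<open>- i\<close> can denote the degree of an inverse.
\<close>
definition homogeneous :: "int \<Rightarrow> ('a \<Rightarrow> 'a) \<Rightarrow> bool" where
  "homogeneous i F \<longleftrightarrow> (\<exists>n. [int n = i] (mod int t) \<and>
     (\<forall>x y. frob t y = y \<longrightarrow> F (y * x) = frob n y * F x))"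

text \<open>
  Semilinear maps of different degrees are independent: let \<open>E\<close> be the fixed field of \<open>frob t\<close>. For fixed
  \<open>x\<close>, replacing \<open>x\<close> by \<open>y x\<close> with \<open>y\<close> in \<open>E\<close> turns the sum into a polynomial in \<open>y\<close> with exponents \<open>1, q, \<dots>, q^(t-1)\<close> that vanishes on
  \<open>E\<close>, hence at no fewer than \<open>q^t\<close> points; its coefficients are the components of the sum.
\<close>
lemma homogeneous_components:
  assumes "\<And>j F. (j, F) \<in> set Fs \<Longrightarrow> homogeneous j F"
    and "\<And>x. (\<Sum>(j, F)\<leftarrow>Fs. F x) = 0"
  shows "(\<Sum>(j, F)\<leftarrow>Fs. if [j = i] (mod int t) then F x else 0) = 0"
proof -
  define r where "r j = nat (j mod int t)" for j
  have r: "r j < t" for j using t by (simp add: r_def nat_less_iff)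
  have r_cong: "r j = r i \<longleftrightarrow> [j = i] (mod int t)" for j i
    using t by (simp add: r_def cong_def nat_eq_iff)
  define p where "p = (\<Sum>(j, F)\<leftarrow>Fs. Polynomial.monom (F x) (q ^ r j))"
  have "poly p y = 0" if y: "frob t y = y" for y
  proof -
    have "poly (Polynomial.monom (F x) (q ^ r j)) y = F (y * x)" if jF: "(j, F) \<in> set Fs" for j F
    proof -
      obtain n where n: "[int n = j] (mod int t)" "F (y * x) = frob n y * F x"
        using assms(1)[OF jF] y unfolding homogeneous_def by blast
      have "int (r j) = j mod int t" using t by (simp add: r_def)
      then have "[int n = int (r j)] (mod int t)" using n(1) by (simp add: cong_def)
      then have "frob n y = frob (r j) y"
        by (intro frob_cong_fixed[OF y]) (simp add: cong_int_iff)
      then show ?thesis using n(2) by (simp add: frob poly_monom mult.commute)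
    qed
    then have "poly p y = (\<Sum>(j, F)\<leftarrow>Fs. F (y * x))"
      unfolding p_def by (induction Fs) auto
    then show ?thesis using assms(2) by simp
  qed
  then have "card {y. frob t y = y} \<le> card {y. poly p y = 0}"
    by (intro card_mono) auto
  then have many: "q ^ t \<le> card {y. poly p y = 0}"
    using card_mid_subfield by linarith
  have "degree p \<le> q ^ (t - 1)"
    unfolding p_def
  proof (induction Fs)
    case (Cons a Fs)
    obtain j F where a: "a = (j, F)" by force
    have "degree (Polynomial.monom (F x) (q ^ r j)) \<le> q ^ r j" by (rule degree_monom_le)
    also have "... \<le> q ^ (t - 1)"
      using r[of j] q_gt_1 by (intro power_increasing) auto
    finally show ?case
      using Cons by (simp add: a degree_add_le)
  qed simp
  also have "... < q ^ t" using q_gt_1 t by (intro power_strict_increasing) auto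
  finally have "p = 0"
    using many card_poly_roots_bound[of p] by force
  moreover have "Polynomial.coeff p (q ^ r i) = (\<Sum>(j, F)\<leftarrow>Fs. if [j = i] (mod int t) then F x else 0)"
    unfolding p_def using q_gt_1
    by (induction Fs) (auto simp: r_cong power_inject_exp)
  ultimately show ?thesis by simp
qed

text \<open>
  Modulo \<open>2t\<close>, \<open>opp n\<close> is \<open>- n\<close>: it is the exponent of the inverse of \<open>frob n\<close>.
\<close>
definition opp :: "nat \<Rightarrow> nat" where "opp n = n * (2 * t - 1)"

lemma int_opp: "int (opp n) = int (2 * t) * int n - int n"
proof -
  have "int (2 * t - 1) = int (2 * t) - 1" using t by simp
  then show ?thesis
    unfolding opp_def of_nat_mult by (simp only:) (simp add: algebra_simps)
qed

lemma conjugation_frob: "conjugation (frob n) (frob (opp n)) (frob t)"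
proof
  have "n + opp n = 2 * t * n"
    using int_opp[of n] by (simp flip: of_nat_eq_iff[where 'a=int])
  then have "frob (n + opp n) x = x" for x
    using frob_mult_period[OF frob_period] by simp
  then show "frob (opp n) (frob n x) = x" "frob n (frob (opp n) x) = x" for x
    by (simp_all add: frob_frob add.commute)
  show "frob t (frob t x) = x" for x
    using frob_period[of x] by (simp add: frob_frob mult_2)
  obtain x where "frob t x \<noteq> x" using frob_neq_id by blast
  moreover have "frob t (frob t x - x) + frob t x = x"
    using frob_add[of t "frob t x - x" x] \<open>\<And>x. frob t (frob t x) = x\<close> by (metis diff_add_cancel)
  ultimately have "frob t x - x \<noteq> 0 \<and> frob t (frob t x - x) = - (frob t x - x)"
    by (simp add: algebra_simps eq_diff_eq)
  then show "\<exists>w. w \<noteq> 0 \<and> frob t w = - w" by blast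
qed (simp_all add: frob_add frob_mult frob_frob add.commute two_neq_0)

sublocale conj: conjugation "frob n" "frob (opp n)" "frob t" for n
  by (rule conjugation_frob)

abbreviation "bar \<equiv> frob t"

lemma cong_mult_odd: "odd s \<Longrightarrow> [s * t = t] (mod 2 * t)"
  by (auto elim!: oddE simp: cong_def algebra_simps)

lemma frob_int_cong: "[int m = int n] (mod 2 * int t) \<Longrightarrow> frob m x = frob n x"
  by (rule frob_cong) (simp flip: cong_int_iff)

lemma cong_opp: "[int (opp n) = - int n] (mod 2 * int t)"
  by (simp add: int_opp cong_iff_dvd_diff)

lemma frob_int_cong_trans:
  assumes "[int n = i] (mod 2 * int t)" "[i = int j] (mod 2 * int t)"
  shows "frob n x = frob j x"
  using frob_int_cong cong_trans[OF assms] .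

lemma int_cong_mult_odd: "odd s \<Longrightarrow> [int s * int t = int t] (mod 2 * int t)"
  using cong_mult_odd[of s] by (simp flip: cong_int_iff)

lemma frob_t_minus_1:
  assumes "odd s" shows "frob (s * (t - 1)) x = frob (opp s) (bar x)"
proof -
  have "[int s * int t - int s = int t - int s] (mod 2 * int t)"
    by (intro cong_diff int_cong_mult_odd assms cong_refl)
  moreover have "[int t + - int s = int t + int (opp s)] (mod 2 * int t)"
    by (intro cong_add cong_refl cong_sym[OF cong_opp])
  ultimately have "[int (s * (t - 1)) = int (opp s + t)] (mod 2 * int t)"
    using t by (auto simp: of_nat_diff algebra_simps intro: cong_trans)
  then show ?thesis using frob_int_cong by (simp add: frob_frob)
qed

lemma frob_t_minus_2:
  assumes "odd s" shows "frob (s * (t - 2)) x = frob (opp s) (frob (opp s) (bar x))"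
proof -
  have "[int s * int t - 2 * int s = int t - 2 * int s] (mod 2 * int t)"
    by (intro cong_diff int_cong_mult_odd assms cong_refl)
  moreover have "[int t + (- int s + - int s) = int t + (int (opp s) + int (opp s))] (mod 2 * int t)"
    by (intro cong_add cong_refl cong_sym[OF cong_opp])
  ultimately have "[int (s * (t - 2)) = int (opp s + (opp s + t))] (mod 2 * int t)"
    using t by (auto simp: of_nat_diff algebra_simps intro: cong_trans)
  then show ?thesis using frob_int_cong by (simp add: frob_frob add.assoc)
qed

end

section \<open>Quadrinomials, admissibility and equivalence\<close>

context frobenius_tower
begin

lemma psi_eq:
  assumes s: "odd s" and h: "h \<noteq> 0" "bar h = e / h" and e: "e = 1 \<or> e = - 1"
  shows "psi q t m h s x = conj.fwd s m h e x + conj.bwd s h x"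
proof -
  have "[s * (t + 1) = s + t] (mod 2 * t)"
    using cong_add[OF cong_refl[of s] cong_mult_odd[OF s]] by (simp add: algebra_simps)
  then have 1: "frob (s * (t + 1)) x = frob s (bar x)" for x
    by (simp add: frob_frob frob_cong)
  note 2 = frob_t_minus_1[OF s]
  have pw: "h powi (1 - int q ^ n) = h / frob n h" for n
    using h(1) by (simp add: power_int_diff frob flip: of_nat_power)
  have "h / frob s (bar h) = e * h * frob s h"
    using e h(1) conj.fix_sign[OF e, of s] by (auto simp: h(2) conj.hom_simps)
  then show ?thesis
    unfolding psi_def pw conj.fwd_def conj.bwd_def frob[symmetric] opp_def[symmetric] 1 2
    by simp
qed

text \<open>
  Suppose \<open>h * h^(q^(2s)) = - e\<close>. Then \<open>frob (2 s)\<close> exchanges \<open>h\<close> and \<open>- e / h\<close>, whereas \<open>frob (s t)\<close>, being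
  \<open>frob t\<close> for odd \<open>s\<close>, sends \<open>h\<close> to \<open>e / h\<close>. For even \<open>t\<close> the latter is a power of the former, and for
  odd \<open>t\<close> it is such a power followed by \<open>frob s\<close>; this forces \<open>h^2 = \<plusminus> e\<close>, hence \<open>h^4 = 1\<close>. For even \<open>t\<close>,
  \<open>h^2 = e\<close>, but \<open>h\<close> is fixed by \<open>frob (2 s)\<close> since \<open>q^2\<close> is 1 modulo 4, so that \<open>h^2 = - e\<close> as well. For odd
  \<open>t\<close>, \<open>h^2 = - e\<close> and \<open>frob s\<close> moves \<open>h\<close>, which is only possible if \<open>h^2 = - 1\<close> and \<open>q\<close> is 3 modulo 4.
\<close>
lemma nondegenerate:
  assumes s: "odd s" and h: "h \<noteq> 0" "bar h = e / h" and e: "e = 1 \<or> e = - 1"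
    and excl: "odd t \<Longrightarrow> [q = 3] (mod 4) \<Longrightarrow> e = 1 \<Longrightarrow> h ^ 2 \<noteq> - 1"
  shows "1 + e * h * frob s (frob s h) \<noteq> 0"
proof
  assume "1 + e * h * frob s (frob s h) = 0"
  then have "e * (h * frob s (frob s h)) = - 1"
    by (simp add: mult.assoc add_eq_0_iff)
  then have "h * frob s (frob s h) = - e"
    using e by (auto simp: minus_equation_iff[of "h * _"])
  then have SS: "frob s (frob s h) = - e / h"
    using h(1) by (simp add: field_simps)
  have e0: "e \<noteq> 0" "e \<noteq> - e" using e two_neq_0 by (auto simp: equation_minus_iff eq_neg_iff_add_eq_0)
  have S1: "frob (2 * s) h = - e / h"
    using SS by (simp add: frob_frob mult_2)
  have S2: "frob (2 * s) (- e / h) = h"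
  proof -
    have "frob (2 * s) (- e / h) = - e / frob (2 * s) h"
      using conj.fix_sign[OF e, of "2 * s"] by (simp add: conj.hom_simps)
    then show ?thesis using e0 by (simp add: S1)
  qed
  have it: "frob (2 * s * j) h = h \<or> frob (2 * s * j) h = - e / h" for j
  proof (induction j)
    case (Suc j)
    have "frob (2 * s * Suc j) h = frob (2 * s) (frob (2 * s * j) h)"
      by (simp add: frob_frob)
    then show ?case using Suc S1 S2 by auto
  qed (simp add: frob_0)
  have st: "frob (s * t) h = e / h"
    using frob_cong[OF cong_mult_odd[OF s]] h(2) by simp
  \<comment> \<open>Fourth roots of unity are fixed by powers of \<open>q\<close> that are 1 modulo 4.\<close>
  have fix4: "frob n y = y" if y: "y ^ 4 = 1" and n: "[q ^ n = 1] (mod 4)" for y n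
  proof -
    obtain r where "q ^ n = 4 * r + 1"
    proof -
      have "q ^ n mod 4 = 1" using n by (simp add: cong_def)
      then have "q ^ n = 4 * (q ^ n div 4) + 1"
        using mult_div_mod_eq[of 4 "q ^ n"] by linarith
      then show thesis using that by blast
    qed
    then show ?thesis by (simp add: frob power_add power_mult y)
  qed
  have h4: "h ^ 4 = 1" if "h * h = e \<or> h * h = - e"
  proof -
    have "h ^ 4 = (h * h) * (h * h)" by (simp add: power4_eq_xxxx mult_ac)
    also have "... = e * e" using that by (elim disjE) (simp_all only: minus_mult_minus)
    also have "... = 1" using e by auto
    finally show ?thesis .
  qed
  have "q mod 4 = 1 \<or> q mod 4 = 3" if "odd q" for q :: nat
    using that by presburger
  from this[OF q(2)] have "[q = 1] (mod 4) \<or> [q = 3] (mod 4)"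
    by (simp add: cong_def)
  then have q2: "[q ^ 2 = 1] (mod 4)"
  proof
    assume "[q = 3] (mod 4)"
    from cong_pow[OF this, of 2] show ?thesis by (simp add: cong_def)
  next
    assume "[q = 1] (mod 4)"
    from cong_pow[OF this, of 2] show ?thesis by (simp add: cong_def)
  qed
  show False
  proof (cases "even t")
    case True
    then obtain j where j: "t = 2 * j" by blast
    then have "frob (2 * s * j) h = e / h" using st by (simp add: mult_ac)
    moreover have "e / h \<noteq> - e / h" using h(1) e0 by (simp add: field_simps)
    ultimately have "h = e / h" using it[of j] by auto
    then have hh: "h * h = e" using h(1) by (simp add: field_simps)
    have "frob (2 * s) h = h"
      using cong_pow[OF q2, of s] by (intro fix4) (simp_all add: h4 hh power_mult)
    then have "h * h = - e" using S1 h(1) by (simp add: field_simps)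
    with hh e0 show False by simp
  next
    case False
    then obtain j where j: "t = 2 * j + 1" by (blast elim: oddE)
    have "frob (s * t) h = frob s (frob (2 * s * j) h)"
      by (simp add: frob_frob j algebra_simps)
    then have "frob s (frob (2 * s * j) h) = e / h" using st by simp
    moreover have "frob s (- e / h) = - e / frob s h"
      using conj.fix_sign[OF e, of s] by (simp add: conj.hom_simps)
    ultimately consider "frob s h = e / h" | "- e / frob s h = e / h"
      using it[of j] by auto
    then have Sh: "(frob s h = e / h \<or> frob s h = - h) \<and> frob s (frob s h) = h"
    proof cases
      case 1
      have "frob s (frob s h) = frob s (e / h)" by (simp add: 1)
      also have "... = e / frob s h"
        using conj.fix_sign[OF e, of s] by (simp add: conj.hom_simps)
      finally show ?thesis using 1 e0 by simp
    next
      case 2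
      then have "- (e * h) = e * frob s h"
        using h(1) by (simp add: field_simps conj.eq_0_iff)
      from this[symmetric] have "e * (frob s h + h) = 0"
        by (simp add: distrib_left)
      then have "frob s h = - h" using e0 by (simp add: eq_neg_iff_add_eq_0)
      then show ?thesis by (simp add: conj.hom_simps)
    qed
    then have hh: "h * h = - e" using SS h(1) by (simp add: field_simps)
    have "frob s h \<noteq> h"
    proof
      assume "frob s h = h"
      with Sh have "h = e / h \<or> h = - h" by auto
      then have "h * h = e \<or> 2 * h = 0"
        using h(1) by (auto simp: field_simps eq_neg_iff_add_eq_0)
      then show False using hh h(1) two_neq_0 e0 by auto
    qed
    moreover have "frob s h = h"
    proof (cases "e = 1")
      case True
      then have "[q = 1] (mod 4)"
        using excl False hh \<open>[q = 1] (mod 4) \<or> [q = 3] (mod 4)\<close> by (auto simp: power2_eq_square)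
      from cong_pow[OF this, of s] have "[q ^ s = 1] (mod 4)" by simp
      then show ?thesis using hh by (intro fix4 h4) auto
    next
      case False
      then have "h * h = 1" using e hh by auto
      then have "(h - 1) * (h + 1) = 0" by (simp add: algebra_simps)
      then have "h = 1 \<or> h = - 1" by (auto simp: eq_neg_iff_add_eq_0)
      then show ?thesis by (auto simp: conj.hom_simps)
    qed
    ultimately show False by simp
  qed
qed

lemma admissibleD:
  assumes "admissible q t s m h" "odd s"
  obtains e where "m \<noteq> 0" "bar m = m" "h \<noteq> 0" "bar h = e / h" "e = 1 \<or> e = - 1"
    "1 + e * h * frob s (frob s h) \<noteq> 0"
proof -
  define e where "e = rel_norm q t h"
  have m: "m \<noteq> 0" "bar m = m"
    using assms(1) by (auto simp: admissible_def subfield_of_order_def frob)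
  have e: "e = 1 \<or> e = - 1"
    using assms(1) by (auto simp: admissible_def e_def)
  have eh: "e = h * bar h" by (simp add: e_def rel_norm_def frob)
  then have h: "h \<noteq> 0" "bar h = e / h" using e by auto
  have excl: "h ^ 2 \<noteq> - 1" if "odd t" "[q = 3] (mod 4)" "e = 1"
  proof -
    have "\<not> [q = 1] (mod 4)" using that(2) by (simp add: cong_def)
    moreover have "(1::'a) \<noteq> - 1" using two_neq_0 by (simp add: eq_neg_iff_add_eq_0)
    ultimately show ?thesis
      using assms(1) that by (auto simp: admissible_def e_def)
  qed
  show thesis
    using that[OF m h e nondegenerate[OF assms(2) h e excl]] .
qed

text \<open>
  If the matrix has rows \<open>(a, b)\<close> and \<open>(c, d)\<close>, the image of the point \<open>(x, f x)\<close> lies on the graph of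
  \<open>g\<close>.
\<close>
lemma GL_equivD:
  assumes "f \<sim>GL (g :: 'a \<Rightarrow> 'a)"
  shows "\<exists>a b c d. a * d - b * c \<noteq> 0 \<and> (\<forall>x. g (a * x + b * f x) = c * x + d * f x)"
proof -
  obtain A :: "'a ^ 2 ^ 2" where A: "invertible A"
    "(\<lambda>v. A *v v) ` graph_subspace f = graph_subspace g"
    using assms unfolding GL_equiv_def by blast
  have "g (A $ 1 $ 1 * x + A $ 1 $ 2 * f x) = A $ 2 $ 1 * x + A $ 2 $ 2 * f x" for x
  proof -
    have "A *v vector [x, f x] \<in> graph_subspace g"
      unfolding A(2)[symmetric] by (intro imageI) (auto simp: graph_subspace_def)
    then obtain y where "A *v vector [x, f x] = vector [y, g y]"
      by (auto simp: graph_subspace_def)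
    then have "(A *v vector [x, f x]) $ 1 = y" "(A *v vector [x, f x]) $ 2 = g y" by simp_all
    then show ?thesis by (simp add: matrix_vector_mult_def sum_2)
  qed
  moreover have "A $ 1 $ 1 * A $ 2 $ 2 - A $ 1 $ 2 * A $ 2 $ 1 \<noteq> 0"
    using A(1) by (simp add: invertible_det_nz det_2)
  ultimately show ?thesis by blast
qed

end

section \<open>Sorting an equivalence by degree\<close>

context frobenius_tower
begin

lemma homogeneous_const: "homogeneous 0 (\<lambda>x. c * x)"
  unfolding homogeneous_def by (intro exI[of _ 0]) (simp add: frob_0 mult_ac)

lemma homogeneous_comp:
  assumes "homogeneous i F" "homogeneous j G"
  shows "homogeneous (i + j) (\<lambda>x. F (G x))"
proof -
  obtain m n where m: "[int m = i] (mod int t)" "\<And>x y. frob t y = y \<Longrightarrow> F (y * x) = frob m y * F x"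
    and n: "[int n = j] (mod int t)" "\<And>x y. frob t y = y \<Longrightarrow> G (y * x) = frob n y * G x"
    using assms unfolding homogeneous_def by blast
  have "F (G (y * x)) = frob (m + n) y * F (G x)" if "frob t y = y" for x y
  proof -
    have "frob t (frob n y) = frob n y"
      using that by (simp add: frob_frob add.commute) (simp flip: frob_frob)
    then show ?thesis using that by (simp add: n(2) m(2) frob_frob)
  qed
  then show ?thesis
    using cong_add[OF m(1) n(1)] unfolding homogeneous_def
    by (intro exI[of _ "m + n"]) simp
qed

lemma homogeneous_cmult: "homogeneous j F \<Longrightarrow> homogeneous j (\<lambda>x. c * F x)"
  using homogeneous_comp[OF homogeneous_const[of c]] by simp

lemma homogeneous_arg_cmult: "homogeneous j F \<Longrightarrow> homogeneous j (\<lambda>x. F (c * x))"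
  using homogeneous_comp[OF _ homogeneous_const[of c]] by force

lemma cong_opp_mod_t: "[int (opp s) = - int s] (mod int t)"
  by (simp add: int_opp cong_iff_dvd_diff)

lemma homogeneous_fwd: "homogeneous (int s) (conj.fwd s m h e)"
  unfolding homogeneous_def
proof (intro exI[of _ s] conjI allI impI)
  show "conj.fwd s m h e (y * x) = frob s y * conj.fwd s m h e x" if "frob t y = y" for x y
    by (simp add: conj.fwd_def conj.hom_simps that algebra_simps)
qed simp

lemma homogeneous_bwd: "homogeneous (- int s) (conj.bwd s h)"
  unfolding homogeneous_def
proof (intro exI[of _ "opp s"] conjI allI impI cong_opp_mod_t)
  show "conj.bwd s h (y * x) = frob (opp s) y * conj.bwd s h x" if "frob t y = y" for x y
    by (simp add: conj.bwd_def conj.hom_simps that algebra_simps)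
qed

lemma fwd_add: "conj.fwd s m h e (x + y) = conj.fwd s m h e x + conj.fwd s m h e y"
  by (simp add: conj.fwd_def conj.hom_simps algebra_simps)

lemma bwd_add: "conj.bwd s h (x + y) = conj.bwd s h x + conj.bwd s h y"
  by (simp add: conj.bwd_def conj.hom_simps algebra_simps)

text \<open>
  The parts of the two quadrinomials have degrees \<open>\<plusminus> l\<close> and \<open>\<plusminus> s\<close>, so an equivalence
  \<open>g (a x + b f x) = c x + d f x\<close> splits into the nine terms below, sorted by degree.
\<close>
lemma equivalence_components:
  fixes i :: int
  assumes "\<And>x. conj.fwd l \<mu> k e' (a * x + b * (conj.fwd s m h e x + conj.bwd s h x))
      + conj.bwd l k (a * x + b * (conj.fwd s m h e x + conj.bwd s h x))
    = c * x + d * (conj.fwd s m h e x + conj.bwd s h x)"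
  shows
    "(if [int l = i] (mod int t) then conj.fwd l \<mu> k e' (a * x) else 0)
   + (if [- int l = i] (mod int t) then conj.bwd l k (a * x) else 0)
   + (if [int l + int s = i] (mod int t) then conj.fwd l \<mu> k e' (b * conj.fwd s m h e x) else 0)
   + (if [int l - int s = i] (mod int t) then conj.fwd l \<mu> k e' (b * conj.bwd s h x) else 0)
   + (if [- int l + int s = i] (mod int t) then conj.bwd l k (b * conj.fwd s m h e x) else 0)
   + (if [- int l - int s = i] (mod int t) then conj.bwd l k (b * conj.bwd s h x) else 0)
   = (if [0 = i] (mod int t) then c * x else 0)
   + (if [int s = i] (mod int t) then d * conj.fwd s m h e x else 0)
   + (if [- int s = i] (mod int t) then d * conj.bwd s h x else 0)" (is "?L = ?R")
proof -
  let ?Fs = "[(int l, \<lambda>x. conj.fwd l \<mu> k e' (a * x)), (- int l, \<lambda>x. conj.bwd l k (a * x)),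
    (int l + int s, \<lambda>x. conj.fwd l \<mu> k e' (b * conj.fwd s m h e x)),
    (int l - int s, \<lambda>x. conj.fwd l \<mu> k e' (b * conj.bwd s h x)),
    (- int l + int s, \<lambda>x. conj.bwd l k (b * conj.fwd s m h e x)),
    (- int l - int s, \<lambda>x. conj.bwd l k (b * conj.bwd s h x)),
    (0, \<lambda>x. (- c) * x), (int s, \<lambda>x. (- d) * conj.fwd s m h e x),
    (- int s, \<lambda>x. (- d) * conj.bwd s h x)]"
  note bs = homogeneous_cmult[OF homogeneous_fwd, where c = b]
    homogeneous_cmult[OF homogeneous_bwd, where c = b]
  have hom: "homogeneous (int l + int s) (\<lambda>x. conj.fwd l \<mu> k e' (b * conj.fwd s m h e x))"
    "homogeneous (int l - int s) (\<lambda>x. conj.fwd l \<mu> k e' (b * conj.bwd s h x))"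
    "homogeneous (- int l + int s) (\<lambda>x. conj.bwd l k (b * conj.fwd s m h e x))"
    "homogeneous (- int l - int s) (\<lambda>x. conj.bwd l k (b * conj.bwd s h x))"
    using homogeneous_comp[OF homogeneous_fwd bs(1)] homogeneous_comp[OF homogeneous_fwd bs(2)]
      homogeneous_comp[OF homogeneous_bwd bs(1)] homogeneous_comp[OF homogeneous_bwd bs(2)]
    by simp_all
  have "homogeneous j F" if "(j, F) \<in> set ?Fs" for j F
    using that hom homogeneous_const[where c = "- c"]
      homogeneous_cmult[OF homogeneous_fwd, where c = "- d"]
      homogeneous_cmult[OF homogeneous_bwd, where c = "- d"]
    by (auto intro: homogeneous_arg_cmult homogeneous_fwd homogeneous_bwd)
  moreover have "(\<Sum>(j, F)\<leftarrow>?Fs. F x) = 0" for x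
    using assms[of x] by (simp add: distrib_left fwd_add bwd_add algebra_simps)
  ultimately have "(\<Sum>(j, F)\<leftarrow>?Fs. if [j = i] (mod int t) then F x else 0) = 0"
    by (rule homogeneous_components)
  moreover have "(if P then (- u) * y else 0) = - (if P then u * y else 0)" for P and u y :: 'a
    by simp
  ultimately have "?L - ?R = 0"
    by (simp only: list.map sum_list.Cons sum_list.Nil prod.case)
      (simp add: algebra_simps split del: if_split)
  then show ?thesis
    by (simp only: right_minus_eq)
qed

text \<open>
  If \<open>l\<close> differs from \<open>\<plusminus> s\<close> modulo \<open>t\<close>, nothing on the left has degree 0, hence \<open>c = 0\<close>. In degree \<open>l\<close> the
  right-hand side is absent, and on the left the image of the forward part at \<open>a x\<close> can only be
  cancelled by compositions ending in the backward part (this happens when \<open>2 l = \<plusminus> s\<close>). As the two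
  image lines meet only in 0, it follows that \<open>a = 0\<close>.
\<close>
lemma no_equivalence_other_degree:
  assumes eq: "\<And>x. conj.fwd l \<mu> k e' (a * x + b * (conj.fwd s m h e x + conj.bwd s h x))
      + conj.bwd l k (a * x + b * (conj.fwd s m h e x + conj.bwd s h x))
    = c * x + d * (conj.fwd s m h e x + conj.bwd s h x)"
    and cop: "coprime (int l) (int t)" "coprime (int s) (int t)"
    and ls: "\<not> [int l = int s] (mod int t)" "\<not> [int l = - int s] (mod int t)"
    and \<mu>: "\<mu> \<noteq> 0" "bar \<mu> = \<mu>" and k: "k \<noteq> 0" "bar k = e' / k" and e': "e' = 1 \<or> e' = - 1"
    and nondeg: "1 + e' * k * frob l (frob l k) \<noteq> 0"
  shows "a = 0 \<and> c = 0"
proof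
  have nl: "\<not> int t dvd int l * j" if "0 < \<bar>j\<bar>" "\<bar>j\<bar> < 5" for j
    using that t cop(1) zdvd_imp_le[of "int t" "\<bar>j\<bar>"]
    by (auto simp: coprime_commute coprime_dvd_mult_right_iff)
  have ns: "\<not> int t dvd int s * j" if "0 < \<bar>j\<bar>" "\<bar>j\<bar> < 5" for j
    using that t cop(2) zdvd_imp_le[of "int t" "\<bar>j\<bar>"]
    by (auto simp: coprime_commute coprime_dvd_mult_right_iff)
  have ds: "\<not> int t dvd int l" "\<not> int t dvd int s" "\<not> int t dvd 2 * int l"
    using nl[of 1] ns[of 1] nl[of 2] by (simp_all add: mult.commute)
  have lsd: "\<not> int t dvd int l - int s" "\<not> int t dvd int l + int s" "\<not> int t dvd int s - int l"
    "\<not> int t dvd int s + int l" "\<not> int t dvd - int l - int s"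
    using ls dvd_diff_commute[of "int t" "int l" "int s"] dvd_minus_iff[of "int t" "int l + int s"]
    by (simp_all add: cong_iff_dvd_diff add.commute)
  have "- int s - int l = - (int l + int s)" by simp
  then have lsd': "\<not> int t dvd - int s - int l"
    using lsd(2) by (simp only: dvd_minus_iff simp_thms)
  have "c * x = 0" for x
    using equivalence_components[OF eq, of 0 x] ds lsd by (simp add: cong_iff_dvd_diff)
  from this[of 1] show "c = 0" by simp
  have "conj.fwd l \<mu> k e' (a * x)
      = conj.bwd l k (- (if [- int l + int s = int l] (mod int t) then b * conj.fwd s m h e x else 0)
          - (if [- int l - int s = int l] (mod int t) then b * conj.bwd s h x else 0))" for x
  proof -
    have neg: "conj.bwd l k (- x) = - conj.bwd l k x" "conj.bwd l k 0 = 0" for x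
      by (simp_all add: conj.bwd_def conj.hom_simps)
    have "\<not> [- int l = int l] (mod int t)" "\<not> [int l + int s = int l] (mod int t)"
      "\<not> [int l - int s = int l] (mod int t)" "\<not> [0 = int l] (mod int t)"
      "\<not> [int s = int l] (mod int t)" "\<not> [- int s = int l] (mod int t)"
      using ds lsd lsd'
      by (simp_all add: cong_iff_dvd_diff add.commute)
    then have "conj.fwd l \<mu> k e' (a * x)
        + (if [- int l + int s = int l] (mod int t) then conj.bwd l k (b * conj.fwd s m h e x) else 0)
        + (if [- int l - int s = int l] (mod int t) then conj.bwd l k (b * conj.bwd s h x) else 0) = 0"
      using equivalence_components[OF eq, of "int l" x] by simp
    then show ?thesis
      by (cases "[- int l + int s = int l] (mod int t)"; cases "[- int l - int s = int l] (mod int t)")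
        (simp_all only: if_True if_False neg bwd_add diff_conv_add_uminus minus_zero add_0_left
          add_0_right eq_neg_iff_add_eq_0 add.assoc minus_add_distrib[symmetric])
  qed
  then have zero: "conj.fwd l \<mu> k e' (a * x) = 0" for x
    by (rule conj.fwd_bwd_images_disjoint[OF k e' \<mu>(2) nondeg])
  obtain x where x: "conj.fwd l \<mu> k e' x \<noteq> 0" using conj.fwd_nz[OF \<mu>(1)] by blast
  show "a = 0"
  proof (rule ccontr)
    assume "a \<noteq> 0"
    then show False using zero[of "x / a"] x by simp
  qed
qed

text \<open>
  For equal degrees, the components of degree \<open>\<plusminus> s\<close>, \<open>\<plusminus> 2 s\<close> and 0 are exactly the hypotheses of
  \<open>proportional_parts\<close> and \<open>annihilating_parts\<close>; \<open>t \<ge> 5\<close> keeps these degrees apart. Which of the two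
  applies depends on whether \<open>a\<close> vanishes.
\<close>
lemma same_degree_equivalence:
  fixes m \<mu> h k a b c d :: 'a
  defines "v \<equiv> h / k"
  assumes eq: "\<And>x. conj.fwd s \<mu> k e' (a * x + b * (conj.fwd s m h e x + conj.bwd s h x))
      + conj.bwd s k (a * x + b * (conj.fwd s m h e x + conj.bwd s h x))
    = c * x + d * (conj.fwd s m h e x + conj.bwd s h x)"
    and inv: "a * d - b * c \<noteq> 0"
    and cop: "coprime (int s) (int t)"
    and m: "m \<noteq> 0" "bar m = m" and h: "h \<noteq> 0" "bar h = e / h" and e: "e = 1 \<or> e = - 1"
    and \<mu>: "\<mu> \<noteq> 0" "bar \<mu> = \<mu>" and k: "k \<noteq> 0" "bar k = e' / k" and e': "e' = 1 \<or> e' = - 1"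
    and nondeg: "1 + e * h * frob s (frob s h) \<noteq> 0"
  shows "frob s (frob s v) * v = e * e' \<and>
    (\<exists>z. z \<noteq> 0 \<and>
      (bar z = - (frob s (frob s (frob s v)) / v) * z \<and>
         m / frob s \<mu> = - (frob (opp s) (frob (opp s) (bar z)) / z) \<or>
       bar z = frob s (frob s (frob s v)) / v * z \<and>
         m / \<mu> = frob (opp s) (frob (opp s) (bar z)) / z))"
proof -
  have ns: "\<not> int t dvd j * int s" if "0 < \<bar>j\<bar>" "\<bar>j\<bar> < 5" for j
    using that t cop zdvd_imp_le[of "int t" "\<bar>j\<bar>"]
    by (auto simp: coprime_commute coprime_dvd_mult_left_iff)
  have neq: "[x = y] (mod int t) \<longleftrightarrow> False" if "x - y = j * int s" "0 < \<bar>j\<bar>" "\<bar>j\<bar> < 5" for x y j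
    using ns[of j] that by (simp add: cong_iff_dvd_diff)
  \<comment> \<open>In each entry, the two degrees differ by the third argument times \<open>s\<close>.\<close>
  let ?s = "int s"
  note neqs = neq[of "?s" "?s + ?s" "- 1"] neq[of "- ?s" "?s + ?s" "- 3"] neq[of "?s - ?s" "?s + ?s" "- 2"]
    neq[of "- ?s + ?s" "?s + ?s" "- 2"] neq[of "- ?s - ?s" "?s + ?s" "- 4"] neq[of "0" "?s + ?s" "- 2"]
    neq[of "?s" "- ?s - ?s" "3"] neq[of "- ?s" "- ?s - ?s" "1"] neq[of "?s - ?s" "- ?s - ?s" "2"]
    neq[of "- ?s + ?s" "- ?s - ?s" "2"] neq[of "?s + ?s" "- ?s - ?s" "4"] neq[of "0" "- ?s - ?s" "2"]
    neq[of "- ?s" "?s" "- 2"] neq[of "?s - ?s" "?s" "- 1"] neq[of "- ?s + ?s" "?s" "- 1"]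
    neq[of "?s + ?s" "?s" "1"] neq[of "- ?s - ?s" "?s" "- 3"] neq[of "0" "?s" "- 1"]
    neq[of "?s" "- ?s" "2"] neq[of "?s - ?s" "- ?s" "1"] neq[of "- ?s + ?s" "- ?s" "1"]
    neq[of "?s + ?s" "- ?s" "3"] neq[of "- ?s - ?s" "- ?s" "- 1"] neq[of "0" "- ?s" "1"]
    neq[of "?s" "0" "1"] neq[of "- ?s" "0" "- 1"] neq[of "?s + ?s" "0" "2"] neq[of "- ?s - ?s" "0" "- 2"]
  note neqs = neqs[simplified]
  note comp = equivalence_components[OF eq]
  have ff: "conj.fwd s \<mu> k e' (b * conj.fwd s m h e x) = 0" for x
    using comp[of "?s + ?s" x] by (simp add: neqs)
  have bb: "conj.bwd s k (b * conj.bwd s h x) = 0" for x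
    using comp[of "- ?s - ?s" x] by (simp add: neqs)
  have fa: "conj.fwd s \<mu> k e' (a * x) = d * conj.fwd s m h e x" for x
    using comp[of "?s" x] by (simp add: neqs)
  have ba: "conj.bwd s k (a * x) = d * conj.bwd s h x" for x
    using comp[of "- ?s" x] by (simp add: neqs)
  have mid: "conj.fwd s \<mu> k e' (b * conj.bwd s h x) + conj.bwd s k (b * conj.fwd s m h e x) = c * x" for x
    using comp[of 0 x] by (simp add: neqs)
  show ?thesis
  proof (cases "a = 0")
    case True
    then have "b \<noteq> 0" using inv by auto
    from conj.annihilating_parts[OF m(1) \<mu>(1) this nondeg m(2) \<mu>(2) h e k e' ff bb mid]
    have res: "frob s (frob s v) * v = e * e'"
      "\<exists>z. bar z = - (frob s (frob s (frob s v)) / v) * z \<and>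
         m / frob s \<mu> = - (frob (opp s) (frob (opp s) (bar z)) / z)"
      unfolding v_def by blast+
    moreover have "m / frob s \<mu> \<noteq> 0" using m \<mu> by (simp add: conj.eq_0_iff)
    ultimately show ?thesis by (metis div_by_0 neg_equal_0_iff_equal)
  next
    case False
    obtain x where x: "conj.fwd s \<mu> k e' x \<noteq> 0" using conj.fwd_nz[OF \<mu>(1)] by blast
    then have "d \<noteq> 0" using fa[of "x / a"] False by auto
    from conj.proportional_parts[OF m(1) \<mu>(1) False this h e k e' fa ba]
    have "frob s (frob s v) * v = e * e'"
      "\<exists>z. bar z = frob s (frob s (frob s v)) / v * z \<and>
         m / \<mu> = frob (opp s) (frob (opp s) (bar z)) / z"
      unfolding v_def by blast+
    moreover have "m / \<mu> \<noteq> 0" using m \<mu> by simp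
    ultimately show ?thesis by (metis div_by_0)
  qed
qed

end

section \<open>Reduction to equal automorphisms\<close>

context frobenius_tower
begin

text \<open>
  The existential clauses of the classification, with the powers of \<open>z\<close> written through automorphisms:
  \<open>z^(q^(st))\<close> is the conjugate of \<open>z\<close> and \<open>z^(q^(s(t-2)))\<close> is \<open>frob (opp s) (frob (opp s) (bar z))\<close>.
\<close>
definition twist :: "nat \<Rightarrow> 'a \<Rightarrow> 'a \<Rightarrow> bool" where
  "twist s \<eta> \<rho> \<longleftrightarrow>
     (\<exists>z. z \<noteq> 0 \<and> bar z = \<eta> * z \<and> \<rho> = frob (opp s) (frob (opp s) (bar z)) / z)"

text \<open>
  Replacing \<open>z\<close> by \<open>z y\<close>. A skew \<open>y\<close>, that is \<open>bar y = - y\<close>, changes the sign of \<open>\<eta>\<close>.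
\<close>
lemma twist_mult:
  assumes "twist s \<eta> \<rho>" "y \<noteq> 0"
  shows "twist s (\<eta> * (bar y / y)) (\<rho> * (frob (opp s) (frob (opp s) (bar y)) / y))"
proof -
  obtain z where "z \<noteq> 0" "bar z = \<eta> * z" "\<rho> = frob (opp s) (frob (opp s) (bar z)) / z"
    using assms(1) unfolding twist_def by blast
  then show ?thesis
    using assms(2) unfolding twist_def
    by (intro exI[of _ "z * y"]) (simp add: conj.hom_simps frob_mult)
qed

lemma power_pred: "z \<noteq> 0 \<Longrightarrow> z ^ (q ^ n - 1) = frob n z / z"
  using q_gt_1 by (simp add: frob power_diff)

lemma frob_triple: "frob (3 * s) x = frob s (frob s (frob s x))"
  by (simp add: frob_frob numeral_3_eq_3)

lemma twistD:
  assumes "twist s \<eta> \<rho>" "odd s"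
  shows "\<exists>z. z ^ (q ^ (s * t)) = \<eta> * z \<and> \<rho> = z ^ (q ^ (s * (t - 2)) - 1)"
proof -
  obtain z where z: "z \<noteq> 0" "bar z = \<eta> * z" "\<rho> = frob (opp s) (frob (opp s) (bar z)) / z"
    using assms(1) unfolding twist_def by blast
  have "z ^ (q ^ (s * t)) = bar z"
    unfolding frob[symmetric] by (rule frob_cong[OF cong_mult_odd[OF assms(2)]])
  then show ?thesis
    using z(2) by (intro exI[of _ z] conjI)
      (simp_all only: z(3) power_pred[OF z(1)] frob_t_minus_2[OF assms(2)])
qed

text \<open>
  Both \<open>bar\<close> and \<open>frob (2 s)\<close> invert \<open>v\<close> up to the same sign, so \<open>frob (s (t - 2))\<close> fixes \<open>v\<close>.
\<close>
lemma ratio_in_subfield: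
  assumes "odd s" "v \<noteq> 0" "bar v = E / v" "frob s (frob s v) * v = E" "E = 1 \<or> E = - 1"
  shows "v \<in> subfield_of_order (q ^ gcd (s * (t - 2)) (2 * t))"
proof -
  have "frob (opp s) (frob (opp s) (frob s (frob s v) * v)) = frob (opp s) (frob (opp s) E)"
    by (simp add: assms(4))
  then have "v * frob (opp s) (frob (opp s) v) = E"
    using conj.fix_sign[OF assms(5), of s] by (simp add: conj.hom_simps)
  moreover have E0: "E \<noteq> 0" using assms(5) by auto
  ultimately have "frob (opp s) (frob (opp s) (bar v)) = v"
    using conj.fix_sign[OF assms(5), of s] assms(2)
    by (auto simp: assms(3) conj.hom_simps field_simps)
  then have "frob (s * (t - 2)) v = v"
    by (simp add: frob_t_minus_2[OF assms(1)])
  moreover have "s * (t - 2) > 0" using t assms(1) by (auto elim: oddE)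
  ultimately have "frob (gcd (s * (t - 2)) (2 * t)) v = v"
    by (intro frob_gcd_fixed frob_period)
  then show ?thesis by (simp add: subfield_of_order_def frob)
qed

text \<open>
  The classification for equal degrees, applied to a \<open>g\<close> that becomes a quadrinomial with the
  automorphism \<open>frob s\<close> after a substitution \<open>x \<mapsto> u x\<close> and a scaling by \<open>w\<close>.
\<close>
lemma equivalence_reduced:
  assumes eq: "psi q t m h s \<sim>GL g"
    and g: "\<And>x. g (u * x) = w * (conj.fwd s \<mu> k e' x + conj.bwd s k x)" and uw: "u \<noteq> 0" "w \<noteq> 0"
    and s: "odd s" "coprime (int s) (int t)" and adm: "admissible q t s m h"
    and \<mu>: "\<mu> \<noteq> 0" "bar \<mu> = \<mu>" and k: "k \<noteq> 0" "bar k = e' / k" and e': "e' = 1 \<or> e' = - 1"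
  shows "h / k \<in> subfield_of_order (q ^ gcd (s * (t - 2)) (2 * t))"
    and "twist s (- ((h / k) ^ (q ^ (3 * s) - 1))) (- (m / frob s \<mu>)) \<or>
         twist s ((h / k) ^ (q ^ (3 * s) - 1)) (m / \<mu>)"
proof -
  obtain e where m: "m \<noteq> 0" "bar m = m" and h: "h \<noteq> 0" "bar h = e / h" and e: "e = 1 \<or> e = - 1"
    and nondeg: "1 + e * h * frob s (frob s h) \<noteq> 0"
    using admissibleD[OF adm s(1)] by blast
  obtain a b c d where inv: "a * d - b * c \<noteq> 0"
    and abcd: "\<And>x. g (a * x + b * psi q t m h s x) = c * x + d * psi q t m h s x"
    using GL_equivD[OF eq] by blast
  define G where "G x = conj.fwd s \<mu> k e' x + conj.bwd s k x" for x
  have "G (a / u * x + b / u * psi q t m h s x) = c / w * x + d / w * psi q t m h s x" for x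
  proof -
    have "w * G (a / u * x + b / u * psi q t m h s x)
        = g (u * (a / u * x + b / u * psi q t m h s x))"
      by (simp add: g G_def)
    also have "u * (a / u * x + b / u * psi q t m h s x) = a * x + b * psi q t m h s x"
      using uw by (simp add: distrib_left)
    also have "g (a * x + b * psi q t m h s x) = w * (c / w * x + d / w * psi q t m h s x)"
      using uw by (simp add: abcd distrib_left)
    finally show ?thesis using uw by simp
  qed
  note eqv = this[unfolded G_def psi_eq[OF s(1) h e]]
  have "a / u * (d / w) - b / u * (c / w) = (a * d - b * c) / (u * w)"
    by (simp add: diff_divide_distrib)
  then have inv': "a / u * (d / w) - b / u * (c / w) \<noteq> 0"
    using inv uw by simp
  let ?v = "h / k"
  note res = same_degree_equivalence[OF eqv inv' s(2) m h e \<mu> k e' nondeg]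
  have E: "e * e' = 1 \<or> e * e' = - 1" using e e' by auto
  have "bar ?v = (e * e') / ?v"
    using h k e' by (auto simp: conj.hom_simps)
  then show "?v \<in> subfield_of_order (q ^ gcd (s * (t - 2)) (2 * t))"
    using res h k by (intro ratio_in_subfield[OF s(1) _ _ _ E]) auto
  have pw: "?v ^ (q ^ (3 * s) - 1) = frob s (frob s (frob s ?v)) / ?v"
    using h k by (subst power_pred) (simp_all add: frob_triple)
  show "twist s (- (?v ^ (q ^ (3 * s) - 1))) (- (m / frob s \<mu>)) \<or>
         twist s (?v ^ (q ^ (3 * s) - 1)) (m / \<mu>)"
    using res unfolding pw twist_def by (metis (no_types, opaque_lifting) minus_equation_iff)
qed

lemma twist_eq_cong: "twist s \<eta> \<rho> \<Longrightarrow> \<eta> = \<eta>' \<Longrightarrow> \<rho> = \<rho>' \<Longrightarrow> twist s \<eta>' \<rho>'"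
  by simp

text \<open>
  The multipliers used with \<open>twist_mult\<close> to remove a skew element \<open>w\<close> from the parameters.
\<close>
lemma skew_multipliers:
  assumes "bar w = - w" "w \<noteq> 0"
  shows "bar (1 / frob s w) / (1 / frob s w) = - 1"
    and "bar (1 / frob s (frob s w)) / (1 / frob s (frob s w)) = - 1"
    and "frob (opp s) (frob (opp s) (bar (1 / frob s w))) / (1 / frob s w) = - (frob s w / frob (opp s) w)"
    and "frob (opp s) (frob (opp s) (bar (1 / frob s (frob s w)))) / (1 / frob s (frob s w))
      = - (frob s (frob s w) / w)"
  using assms by (simp_all add: conj.hom_simps)

context
  fixes s l :: nat and m h \<mu> k :: 'a
  assumes s: "odd s" "coprime (int s) (int t)" and l: "odd l"
    and adm: "admissible q t s m h" "admissible q t l \<mu> k"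
    and equiv: "psi q t m h s \<sim>GL psi q t \<mu> k l"
begin

text \<open>
  The homomorphism laws at the exponent \<open>s\<close> alone: with a variable exponent, the law by which \<open>frob t\<close>
  and \<open>frob n\<close> commute would also apply in the reverse direction.
\<close>
lemmas hom_simps_s = conjugation.hom_simps[OF conjugation_frob[of s]]

text \<open>
  Here the automorphisms agree. A multiplier \<open>1 / frob s \<mu>\<close> exchanges \<open>frob s \<mu>\<close> and
  \<open>frob (opp s) \<mu>\<close>.
\<close>
lemma case_same:
  assumes ls: "[int l = int s] (mod 2 * int t)"
  shows "h / k \<in> subfield_of_order (q ^ gcd (s * (t - 2)) (2 * t))"
    and "twist s (- ((h / k) ^ (q ^ (3 * s) - 1))) (- (m / frob (opp s) \<mu>)) \<or>
      twist s ((h / k) ^ (q ^ (3 * s) - 1)) (m / \<mu>)"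
proof -
  obtain e where \<mu>: "\<mu> \<noteq> 0" "bar \<mu> = \<mu>" and k: "k \<noteq> 0" "bar k = e / k" and e: "e = 1 \<or> e = - 1"
    using admissibleD[OF adm(2) l] by blast
  have fl: "frob l x = frob s x" for x
    by (rule frob_int_cong[OF ls])
  have fol: "frob (opp l) x = frob (opp s) x" for x
    using conj.T_S[of l "frob (opp s) x"] by (simp add: fl hom_simps_s)
  have "psi q t \<mu> k l (1 * x) = 1 * (conj.fwd s \<mu> k e x + conj.bwd s k x)" for x
    unfolding psi_eq[OF l k e] conj.fwd_def conj.bwd_def fl fol by simp
  note res = equivalence_reduced[OF equiv this _ _ s adm(1) \<mu> k e]
  show "h / k \<in> subfield_of_order (q ^ gcd (s * (t - 2)) (2 * t))"
    using res(1) by simp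
  have "twist s \<eta> (- (m / frob s \<mu>)) \<Longrightarrow> twist s \<eta> (- (m / frob (opp s) \<mu>))" for \<eta>
    by (erule twist_mult[where y = "1 / frob s \<mu>", THEN twist_eq_cong])
      (use \<mu> in \<open>simp_all add: hom_simps_s\<close>)
  then show "twist s (- ((h / k) ^ (q ^ (3 * s) - 1))) (- (m / frob (opp s) \<mu>)) \<or>
      twist s ((h / k) ^ (q ^ (3 * s) - 1)) (m / \<mu>)"
    using res(2) by auto
qed

text \<open>
  Substituting \<open>k w x\<close> with a skew \<open>w\<close> exchanges forward and backward part and replaces \<open>k\<close> by \<open>1 / k\<close>
  and \<open>\<mu>\<close> by a multiple of \<open>1 / \<mu>\<close>.
\<close>
lemma case_opposite:
  assumes ls: "[int l = - int s] (mod 2 * int t)"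
  shows "k * h \<in> subfield_of_order (q ^ gcd (s * (t - 2)) (2 * t))"
    and "twist s ((k * h) ^ (q ^ (3 * s) - 1)) (m * frob s \<mu>) \<or>
      twist s (- ((k * h) ^ (q ^ (3 * s) - 1))) (- (m * \<mu>))"
proof -
  obtain e where \<mu>: "\<mu> \<noteq> 0" "bar \<mu> = \<mu>" and k: "k \<noteq> 0" "bar k = e / k" and e: "e = 1 \<or> e = - 1"
    using admissibleD[OF adm(2) l] by blast
  have fl: "frob l x = frob (opp s) x" for x
    by (rule frob_int_cong_trans[OF ls cong_sym[OF cong_opp]])
  have fol: "frob (opp l) x = frob s x" for x
    using conj.T_S[of l "frob s x"] by (simp add: fl hom_simps_s)
  obtain w where w: "w \<noteq> 0" "bar w = - w" using conj.ex_skew by blast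
  define \<mu>' where "\<mu>' = frob s w / (frob (opp s) w * \<mu>)"
  have \<mu>': "\<mu>' \<noteq> 0" "bar \<mu>' = \<mu>'"
    using w \<mu> by (simp_all add: \<mu>'_def hom_simps_s)
  have k': "1 / k \<noteq> 0" "bar (1 / k) = e / (1 / k)"
    using k e by (auto simp: hom_simps_s)
  have "psi q t \<mu> k l (k * w * x)
      = (\<mu> * k * frob (opp s) w) * (conj.fwd s \<mu>' (1 / k) e x + conj.bwd s (1 / k) x)" for x
    unfolding psi_eq[OF l k e] conj.fwd_def conj.bwd_def fl fol \<mu>'_def
    using k(1) w(1) \<mu>(1) e
    by (auto simp: hom_simps_s k(2) w(2) conj.fix_sign[OF e, of s] field_simps)
  note res = equivalence_reduced[OF equiv this _ _ s adm(1) \<mu>' k' e]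
  have hk: "h / (1 / k) = k * h" by simp
  show "k * h \<in> subfield_of_order (q ^ gcd (s * (t - 2)) (2 * t))"
    using res(1)[unfolded hk] k w \<mu> by (simp add: conj.eq_0_iff)
  have 1: "twist s (- \<eta>) (- (m / frob s \<mu>')) \<Longrightarrow> twist s \<eta> (m * frob s \<mu>)" for \<eta>
    by (erule twist_mult[where y = "1 / frob s (frob s w)", THEN twist_eq_cong])
      (use \<mu>(1) w in \<open>simp_all add: \<mu>'_def skew_multipliers hom_simps_s\<close>)
  have 2: "twist s \<eta> (m / \<mu>') \<Longrightarrow> twist s (- \<eta>) (- (m * \<mu>))" for \<eta>
    by (erule twist_mult[where y = "1 / frob s w", THEN twist_eq_cong])
      (use \<mu>(1) w in \<open>simp_all add: \<mu>'_def skew_multipliers hom_simps_s\<close>)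
  show "twist s ((k * h) ^ (q ^ (3 * s) - 1)) (m * frob s \<mu>) \<or>
      twist s (- ((k * h) ^ (q ^ (3 * s) - 1))) (- (m * \<mu>))"
    using res(2)[unfolded hk] 1 2 k w \<mu> by (auto simp: conj.eq_0_iff)
qed

text \<open>
  With \<open>bar\<close> composed into the automorphism, the two parts are exchanged without inverting \<open>k\<close>; the
  skew substitution only corrects a sign.
\<close>
lemma case_conj_opposite:
  assumes ls: "[int l = int t - int s] (mod 2 * int t)"
  shows "h / k \<in> subfield_of_order (q ^ gcd (s * (t - 2)) (2 * t))"
    and "twist s ((h / k) ^ (q ^ (3 * s) - 1)) (- (m * frob s \<mu>)) \<or>
      twist s (- ((h / k) ^ (q ^ (3 * s) - 1))) (m * \<mu>)"
proof -
  obtain e where \<mu>: "\<mu> \<noteq> 0" "bar \<mu> = \<mu>" and k: "k \<noteq> 0" "bar k = e / k" and e: "e = 1 \<or> e = - 1"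
    using admissibleD[OF adm(2) l] by blast
  have "[int t + - int s = int (t + opp s)] (mod 2 * int t)"
    unfolding of_nat_add by (intro cong_add cong_refl cong_sym[OF cong_opp])
  then have fl: "frob l x = bar (frob (opp s) x)" for x
    using frob_int_cong_trans[OF ls] by (simp add: frob_frob)
  have fol: "frob (opp l) x = bar (frob s x)" for x
    using conj.T_S[of l "bar (frob s x)"]
    by (simp only: fl conj.B_T[of s] conj.B_B conj.T_S)
  obtain w where w: "w \<noteq> 0" "bar w = - w" using conj.ex_skew by blast
  define \<mu>' where "\<mu>' = - frob s w / (frob (opp s) w * \<mu>)"
  have \<mu>': "\<mu>' \<noteq> 0" "bar \<mu>' = \<mu>'"
    using w \<mu> by (simp_all add: \<mu>'_def hom_simps_s)
  have "psi q t \<mu> k l (w * x)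
      = (- \<mu> * frob (opp s) w) * (conj.fwd s \<mu>' k e x + conj.bwd s k x)" for x
    unfolding psi_eq[OF l k e] conj.fwd_def conj.bwd_def fl fol \<mu>'_def
    using k(1) w(1) \<mu>(1) e
    by (auto simp: hom_simps_s k(2) w(2) conj.fix_sign[OF e, of s] field_simps)
  note res = equivalence_reduced[OF equiv this _ _ s adm(1) \<mu>' k e]
  show "h / k \<in> subfield_of_order (q ^ gcd (s * (t - 2)) (2 * t))"
    using res(1) k w \<mu> by (simp add: conj.eq_0_iff)
  have 1: "twist s (- \<eta>) (- (m / frob s \<mu>')) \<Longrightarrow> twist s \<eta> (- (m * frob s \<mu>))" for \<eta>
    by (erule twist_mult[where y = "1 / frob s (frob s w)", THEN twist_eq_cong])
      (use \<mu>(1) w in \<open>simp_all add: \<mu>'_def skew_multipliers hom_simps_s\<close>)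
  have 2: "twist s \<eta> (m / \<mu>') \<Longrightarrow> twist s (- \<eta>) (m * \<mu>)" for \<eta>
    by (erule twist_mult[where y = "1 / frob s w", THEN twist_eq_cong])
      (use \<mu>(1) w in \<open>simp_all add: \<mu>'_def skew_multipliers hom_simps_s\<close>)
  show "twist s ((h / k) ^ (q ^ (3 * s) - 1)) (- (m * frob s \<mu>)) \<or>
      twist s (- ((h / k) ^ (q ^ (3 * s) - 1))) (m * \<mu>)"
    using res(2) 1 2 k w \<mu> by (auto simp: conj.eq_0_iff)
qed

text \<open>
  Substituting \<open>k x\<close> removes the \<open>bar\<close> in the automorphism at the cost of inverting \<open>k\<close> and changing
  the sign of \<open>\<mu>\<close>.
\<close>
lemma case_conj_same:
  assumes ls: "[int l = int t + int s] (mod 2 * int t)"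
  shows "h * k \<in> subfield_of_order (q ^ gcd (s * (t - 2)) (2 * t))"
    and "twist s (- ((h * k) ^ (q ^ (3 * s) - 1))) (m / frob (opp s) \<mu>) \<or>
      twist s ((h * k) ^ (q ^ (3 * s) - 1)) (- (m / \<mu>))"
proof -
  obtain e where \<mu>: "\<mu> \<noteq> 0" "bar \<mu> = \<mu>" and k: "k \<noteq> 0" "bar k = e / k" and e: "e = 1 \<or> e = - 1"
    using admissibleD[OF adm(2) l] by blast
  have fl: "frob l x = bar (frob s x)" for x
    using frob_int_cong[of l "t + s"] ls by (simp add: frob_frob)
  have fol: "frob (opp l) x = bar (frob (opp s) x)" for x
    using conj.T_S[of l "bar (frob (opp s) x)"]
    by (simp only: fl conj.B_S[of s] conj.B_B conj.S_T)
  have \<mu>': "- \<mu> \<noteq> 0" "bar (- \<mu>) = - \<mu>"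
    using \<mu> by (simp_all add: hom_simps_s)
  have k': "1 / k \<noteq> 0" "bar (1 / k) = e / (1 / k)"
    using k e by (auto simp: hom_simps_s)
  have "psi q t \<mu> k l (k * x) = k * (conj.fwd s (- \<mu>) (1 / k) e x + conj.bwd s (1 / k) x)" for x
    unfolding psi_eq[OF l k e] conj.fwd_def conj.bwd_def fl fol
    using k(1) \<mu>(1) e
    by (auto simp: hom_simps_s k(2) conj.fix_sign[OF e, of s] field_simps)
  note res = equivalence_reduced[OF equiv this _ _ s adm(1) \<mu>' k' e]
  have hk: "h / (1 / k) = h * k" by simp
  show "h * k \<in> subfield_of_order (q ^ gcd (s * (t - 2)) (2 * t))"
    using res(1) k by (simp add: hk)
  have "twist s \<eta> (- (m / frob s (- \<mu>))) \<Longrightarrow> twist s \<eta> (m / frob (opp s) \<mu>)" for \<eta>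
    by (erule twist_mult[where y = "1 / frob s \<mu>", THEN twist_eq_cong])
      (use \<mu> in \<open>simp_all add: hom_simps_s\<close>)
  then show "twist s (- ((h * k) ^ (q ^ (3 * s) - 1))) (m / frob (opp s) \<mu>) \<or>
      twist s ((h * k) ^ (q ^ (3 * s) - 1)) (- (m / \<mu>))"
    using res(2)[unfolded hk] k by auto
qed

end

lemma case_other:
  fixes m h \<mu> k :: 'a
  assumes s: "odd s" "coprime (int s) (int t)" and l: "odd l" "coprime (int l) (int t)"
    and adm: "admissible q t s m h" "admissible q t l \<mu> k"
    and ls: "\<not> [int l = int s] (mod 2 * int t)" "\<not> [int l = - int s] (mod 2 * int t)"
      "\<not> [int l = int t + int s] (mod 2 * int t)" "\<not> [int l = int t - int s] (mod 2 * int t)"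
  shows "\<not> (psi q t m h s \<sim>GL psi q t \<mu> k l)"
proof
  assume "psi q t m h s \<sim>GL psi q t \<mu> k l"
  from GL_equivD[OF this] obtain a b c d where inv: "a * d - b * c \<noteq> 0"
    and abcd: "\<And>x. psi q t \<mu> k l (a * x + b * psi q t m h s x) = c * x + d * psi q t m h s x"
    by blast
  obtain e where h: "h \<noteq> 0" "bar h = e / h" and e: "e = 1 \<or> e = - 1"
    using admissibleD[OF adm(1) s(1)] by blast
  obtain e' where \<mu>: "\<mu> \<noteq> 0" "bar \<mu> = \<mu>" and k: "k \<noteq> 0" "bar k = e' / k" and e': "e' = 1 \<or> e' = - 1"
    and nondeg: "1 + e' * k * frob l (frob l k) \<noteq> 0"
    using admissibleD[OF adm(2) l(1)] by blast
  have double: "[i = j] (mod 2 * int t) \<or> [i = int t + j] (mod 2 * int t)" if "[i = j] (mod int t)" for i j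
  proof -
    obtain r where r: "i - j = int t * r"
      using \<open>[i = j] (mod int t)\<close> by (auto simp: cong_iff_dvd_diff)
    show ?thesis
    proof (cases "even r")
      case True
      then show ?thesis using r by (auto simp: cong_iff_dvd_diff)
    next
      case False
      then obtain r' where "r = 2 * r' + 1" by (blast elim: oddE)
      then have "i - (int t + j) = 2 * int t * r'" using r by (simp add: algebra_simps)
      then show ?thesis by (simp add: cong_iff_dvd_diff)
    qed
  qed
  have "\<not> [int l = int s] (mod int t)" "\<not> [int l = - int s] (mod int t)"
    using double ls by fastforce+
  from no_equivalence_other_degree[OF abcd[unfolded psi_eq[OF s(1) h e] psi_eq[OF l(1) k e']]
      l(2) s(2) this \<mu> k e' nondeg]
  show False using inv by simp
qed

lemma powi_minus: "x powi - (int q ^ n) = 1 / frob n x"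
  by (simp add: frob power_int_minus divide_inverse flip: of_nat_power)

end

section \<open>The classification\<close>

theorem theorem4p3:
  fixes q t s l :: nat
    and m \<mu> h k :: "'a::{field,finite}"
  assumes q: "primepow q" "odd q"
    and card: "CARD('a) = q ^ (2 * t)"
    and t: "t \<ge> 5"
    and s: "s > 0" "gcd s (2 * t) = 1"
    and l: "l > 0" "gcd l (2 * t) = 1"
    and m_\<mu>: "m \<in> subfield_of_order (q ^ t)" "\<mu> \<in> subfield_of_order (q ^ t)"
    and adm: "admissible q t s m h" "admissible q t l \<mu> k"
  shows
    "(\<not> [int l = int s] (mod int (2 * t)) \<and> \<not> [int l = - int s] (mod int (2 * t)) \<and>
      \<not> [int l = int t + int s] (mod int (2 * t)) \<and> \<not> [int l = int t - int s] (mod int (2 * t))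
        \<longrightarrow> \<not> (psi q t m h s \<sim>GL psi q t \<mu> k l))
   \<and> ([int l = - int s] (mod int (2 * t)) \<and> psi q t m h s \<sim>GL psi q t \<mu> k l
        \<longrightarrow> k * h \<in> subfield_of_order (q ^ gcd (t - 2) (2 * t)) \<and>
          ((\<exists>z. z ^ (q ^ (s * t)) = (k * h) ^ (q ^ (3 * s) - 1) * z \<and>
                m * \<mu> ^ (q ^ s) = z ^ (q ^ (s * (t - 2)) - 1)) \<or>
           (\<exists>z. z ^ (q ^ (s * t)) = - ((k * h) ^ (q ^ (3 * s) - 1)) * z \<and>
                m * \<mu> = - (z ^ (q ^ (s * (t - 2)) - 1)))))
   \<and> ([int l = int s] (mod int (2 * t)) \<and> psi q t m h s \<sim>GL psi q t \<mu> k l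
        \<longrightarrow> h / k \<in> subfield_of_order (q ^ gcd (s * (t - 2)) (2 * t)) \<and>
          ((\<exists>z. z ^ (q ^ (s * t)) = - ((h / k) ^ (q ^ (3 * s) - 1)) * z \<and>
                m * \<mu> powi (- (int q ^ (s * (t - 1)))) = - (z ^ (q ^ (s * (t - 2)) - 1))) \<or>
           (\<exists>z. z ^ (q ^ (s * t)) = (h / k) ^ (q ^ (3 * s) - 1) * z \<and>
                m / \<mu> = z ^ (q ^ (s * (t - 2)) - 1))))
   \<and> ([int l = int t - int s] (mod int (2 * t)) \<and> psi q t m h s \<sim>GL psi q t \<mu> k l
        \<longrightarrow> h / k \<in> subfield_of_order (q ^ gcd (s * (t - 2)) (2 * t)) \<and>
          ((\<exists>z. z ^ (q ^ (s * t)) = (h / k) ^ (q ^ (3 * s) - 1) * z \<and>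
                m * \<mu> ^ (q ^ s) = - (z ^ (q ^ (s * (t - 2)) - 1))) \<or>
           (\<exists>z. z ^ (q ^ (s * t)) = - ((h / k) ^ (q ^ (3 * s) - 1)) * z \<and>
                m * \<mu> = z ^ (q ^ (s * (t - 2)) - 1))))
   \<and> ([int l = int t + int s] (mod int (2 * t)) \<and> psi q t m h s \<sim>GL psi q t \<mu> k l
        \<longrightarrow> h * k \<in> subfield_of_order (q ^ gcd (s * (t - 2)) (2 * t)) \<and>
          ((\<exists>z. z ^ (q ^ (s * t)) = - ((h * k) ^ (q ^ (3 * s) - 1)) * z \<and>
                m * \<mu> powi (- (int q ^ (s * (t - 1)))) = z ^ (q ^ (s * (t - 2)) - 1)) \<or>
           (\<exists>z. z ^ (q ^ (s * t)) = (h * k) ^ (q ^ (3 * s) - 1) * z \<and>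
                m / \<mu> = - (z ^ (q ^ (s * (t - 2)) - 1)))))"
proof -
  define frob :: "nat \<Rightarrow> 'a \<Rightarrow> 'a" where "frob n x = x ^ (q ^ n)" for n x
  interpret frobenius_tower q t frob
    by standard (use q card t in \<open>simp_all add: frob_def\<close>)
  have unit: "odd n \<and> coprime (int n) (int t)" if "gcd n (2 * t) = 1" for n
  proof -
    have "coprime n (2 * t)" using that by (simp only: coprime_iff_gcd_eq_1)
    then show ?thesis by simp
  qed
  have so: "odd s" "coprime (int s) (int t)" and lo: "odd l" "coprime (int l) (int t)"
    using unit[OF s(2)] unit[OF l(2)] by blast+
  have mod: "int (2 * t) = 2 * int t" by simp
  have gcd: "gcd (t - 2) (2 * t) = gcd (s * (t - 2)) (2 * t)"
    using s(2) by (intro gcd_mult_left_left_cancel[symmetric]) (simp only: coprime_iff_gcd_eq_1 gcd.commute)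
  have "bar \<mu> = \<mu>"
    using m_\<mu>(2) by (simp add: subfield_of_order_def frob_def)
  then have powi: "m * \<mu> powi (- (int q ^ (s * (t - 1)))) = m / frob (opp s) \<mu>"
    by (simp only: powi_minus frob_t_minus_1[OF so(1)] times_divide_eq_right mult_1_right)
  have pow: "\<mu> ^ (q ^ s) = frob s \<mu>" by (simp add: frob_def)
  have pos: "\<exists>z. z ^ (q ^ (s * t)) = \<eta> * z \<and> \<rho> = z ^ (q ^ (s * (t - 2)) - 1)"
    if "twist s \<eta> \<rho>" for \<eta> \<rho>
    using twistD[OF that so(1)] .
  have neg: "\<exists>z. z ^ (q ^ (s * t)) = \<eta> * z \<and> \<rho> = - (z ^ (q ^ (s * (t - 2)) - 1))"
    if "twist s \<eta> (- \<rho>)" for \<eta> \<rho>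
    using twistD[OF that so(1)] by (simp add: minus_equation_iff[of \<rho>] eq_commute)
  show ?thesis
    unfolding mod gcd powi pow
    apply (intro conjI impI; (elim conjE)?)
    subgoal by (rule case_other[OF so lo adm])
    subgoal by (rule case_opposite(1)[OF so lo(1) adm])
    subgoal premises p
      using case_opposite(2)[OF so lo(1) adm p(2,1)] by (elim disj_forward pos neg)
    subgoal by (rule case_same(1)[OF so lo(1) adm])
    subgoal premises p
      using case_same(2)[OF so lo(1) adm p(2,1)] by (elim disj_forward pos neg)
    subgoal by (rule case_conj_opposite(1)[OF so lo(1) adm])
    subgoal premises p
      using case_conj_opposite(2)[OF so lo(1) adm p(2,1)] by (elim disj_forward pos neg)
    subgoal by (rule case_conj_same(1)[OF so lo(1) adm])
    subgoal premises p
      using case_conj_same(2)[OF so lo(1) adm p(2,1)] by (elim disj_forward pos neg)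
    done
qed

end
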